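(* (Monodromy space of type $(0,0,1/2)$, degenerate Painlevé V.) Let $\mathcal{R}$ be the affine variety of triples $(M_0,M_1,M_\infty)$ with $M_0,M_1\in SL_2(\mathbb{C})$, $M_\infty=\begin{pmatrix}0&-1\\ 1&0\end{pmatrix}\begin{pmatrix}1&0\\ e&1\end{pmatrix}$ for some $e\in\mathbb{C}$, and $M_0M_1M_\infty=1$. Write $M_1=\begin{pmatrix}a_1&b_1\\ c_1&d_1\end{pmatrix}$ and let $\mathcal{R}\to\mathcal{P}=\mathbb{C}\times\mathbb{C}$ be given by $(s_0,s_1)=(\mathrm{tr}\,M_0,\mathrm{tr}\,M_1)$. With $x_1=-b_1$, $x_2=-a_1$, $x_3=-e$, the coordinate ring of $\mathcal{R}$ is $$\mathbb{C}[x_1,x_2,x_3,s_0,s_1]/(x_1x_2x_3+x_1^2+x_2^2+s_0x_1+s_1x_2+1),$$ so $\mathcal{R}\to\mathcal{P}$ is a family of affine cubic surfaces. The variety $\mathcal{R}$ is non-singular. The fibre over $(s_0,s_1)$ is singular if and only if $s_0=\pm2$ or $s_1=\pm2$; if exactly one of $s_0,s_1$ lies in $\{2,-2\}$ the fibre has exactly one singular point, and if both lie in $\{2,-2\}$ it has exactly two singular points. All these surface singularities are of type $A_1$.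
   Context: A surface singularity is of type $A_n$ if it is locally analytically given by $x^2+y^2+z^{n+1}=0$. Origin of the data: rank-two differential modules on $\mathbb{P}^1$ (trivial determinant) with regular singularities at $0,1$ and a ramified irregular singularity of Katz invariant $1/2$ at $\infty$; $M_\infty$ is the product of formal monodromy and the single Stokes matrix. The remaining basis change (by scalars) acts trivially, so the space of data is itself the monodromy space. *)

theory Defs
  imports
    "HOL-Analysis.Analysis"
    "HOL-Library.Poly_Mapping"
    "HOL-Algebra.QuotRing"
begin

section \<open>Polynomials on the affine space \<open>complex ^ 'n\<close>\<close>

text \<open>A polynomial in variables indexed by \<open>'n\<close> is a finitely supported map from monomials
  (exponent vectors) to coefficients; its ring structure is the convolution product of
  \<^theory>\<open>HOL-Library.Poly_Mapping\<close>.\<close>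

type_synonym 'n mpoly = "('n \<Rightarrow>\<^sub>0 nat) \<Rightarrow>\<^sub>0 complex"

definition Var :: "'n \<Rightarrow> 'n mpoly"
  where "Var i = Poly_Mapping.single (Poly_Mapping.single i 1) 1"

definition Const :: "complex \<Rightarrow> 'n mpoly"
  where "Const c = Poly_Mapping.single 0 c"

definition peval :: "'n::finite mpoly \<Rightarrow> complex ^ 'n \<Rightarrow> complex"
  where "peval p x =
    (\<Sum>m\<in>Poly_Mapping.keys p. Poly_Mapping.lookup p m * (\<Prod>i\<in>UNIV. (x $ i) ^ Poly_Mapping.lookup m i))"

definition total_degree :: "'n::finite mpoly \<Rightarrow> nat"
  where "total_degree p = Max (insert 0 ((\<lambda>m. \<Sum>i\<in>UNIV. Poly_Mapping.lookup m i) ` Poly_Mapping.keys p))"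

definition poly_ring :: "'n mpoly ring"
  where "poly_ring = \<lparr>carrier = UNIV, mult = (*), one = 1, zero = 0, add = (+)\<rparr>"

lemma cring_poly_ring: "cring (poly_ring :: 'n mpoly ring)"
proof (rule cringI)
  show "abelian_group (poly_ring :: 'n mpoly ring)"
  proof (rule abelian_groupI)
    fix x :: "'n mpoly"
    have "- x + x = 0" by simp
    then show "\<exists>y\<in>carrier poly_ring. y \<oplus>\<^bsub>poly_ring\<^esub> x = \<zero>\<^bsub>poly_ring\<^esub>"
      unfolding poly_ring_def by (intro bexI[of _ "- x"]) simp_all
  qed (simp_all add: poly_ring_def ac_simps)
  show "comm_monoid (poly_ring :: 'n mpoly ring)"
    by (rule comm_monoidI) (simp_all add: poly_ring_def ac_simps)
qed (simp add: poly_ring_def distrib_right)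


section \<open>Affine algebraic sets and their coordinate rings\<close>

definition algebraic_set :: "(complex ^ 'n::finite) set \<Rightarrow> bool"
  where "algebraic_set V \<longleftrightarrow> (\<exists>S. V = {x. \<forall>p\<in>S. peval p x = 0})"

definition vanishing_ideal :: "(complex ^ 'n::finite) set \<Rightarrow> 'n mpoly set"
  where "vanishing_ideal V = {p. \<forall>x\<in>V. peval p x = 0}"

text \<open>The ring of regular (polynomial) functions on \<open>V\<close>, with pointwise operations; functions
  are made extensional so that equality in the carrier is equality on \<open>V\<close>.\<close>

definition coordinate_ring :: "(complex ^ 'n::finite) set \<Rightarrow> (complex ^ 'n \<Rightarrow> complex) ring"
  where "coordinate_ring V =
    \<lparr>carrier = {restrict (peval p) V | p. True},
     mult = (\<lambda>f g. \<lambda>x\<in>V. f x * g x), one = (\<lambda>x\<in>V. 1),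
     zero = (\<lambda>x\<in>V. 0), add = (\<lambda>f g. \<lambda>x\<in>V. f x + g x)\<rparr>"

text \<open>With respect to the functions \<open>\<phi>\<close> (one for each variable), the coordinate ring of \<open>V\<close> is the
  polynomial ring modulo \<open>f\<close>: sending the class of the \<open>i\<close>-th variable to the \<open>i\<close>-th component
  of \<open>\<phi>\<close>, hence the class of \<open>p\<close> to \<open>p \<circ> \<phi>\<close>, is a well-defined ring isomorphism. The case of constant
  \<open>p\<close> makes it an isomorphism of algebras over the complex numbers; the case of a variable
  makes the components of \<open>\<phi>\<close> regular functions.\<close>

definition coordinate_ring_presentation ::
    "(complex ^ 'n::finite) set \<Rightarrow> (complex ^ 'n \<Rightarrow> complex ^ 'm::finite) \<Rightarrow> 'm mpoly \<Rightarrow> bool"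
  where "coordinate_ring_presentation V \<phi> f \<longleftrightarrow>
    (\<exists>h \<in> ring_iso (poly_ring Quot (PIdl\<^bsub>poly_ring\<^esub> f)) (coordinate_ring V).
       \<forall>p. \<forall>x\<in>V. h (PIdl\<^bsub>poly_ring\<^esub> f +>\<^bsub>poly_ring\<^esub> p) x = peval p (\<phi> x))"


section \<open>Singular points\<close>

definition gradient :: "'n::finite mpoly \<Rightarrow> complex ^ 'n \<Rightarrow> complex ^ 'n"
  where "gradient p x = (\<chi> i. deriv (\<lambda>t. peval p (x + t *s axis i 1)) 0)"

text \<open>\<open>V\<close> is non-singular (smooth) at \<open>x\<close> if the ideal of \<open>V\<close> in the local ring of the affine space
  at \<open>x\<close> is generated by finitely many polynomials with linearly independent differentials at
  \<open>x\<close>. Their number is then the codimension of \<open>V\<close> at \<open>x\<close>, so that no notion of dimension has to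
  be referred to. The multiplier \<open>h\<close> clears denominators in the local ring.\<close>

definition nonsingular_at :: "(complex ^ 'n::finite) set \<Rightarrow> complex ^ 'n \<Rightarrow> bool"
  where "nonsingular_at V x \<longleftrightarrow>
    (\<exists>G. finite G \<and> G \<subseteq> vanishing_ideal V \<and>
         inj_on (\<lambda>g. gradient g x) G \<and> vec.independent ((\<lambda>g. gradient g x) ` G) \<and>
         (\<forall>f\<in>vanishing_ideal V. \<exists>h. peval h x \<noteq> 0 \<and> h * f \<in> Idl\<^bsub>poly_ring\<^esub> G))"

definition singular_points :: "(complex ^ 'n::finite) set \<Rightarrow> (complex ^ 'n) set"
  where "singular_points V = {x \<in> V. \<not> nonsingular_at V x}"

definition holomorphic_map_on ::
    "(complex ^ 'n::finite \<Rightarrow> complex ^ 'm::finite) \<Rightarrow> (complex ^ 'n) set \<Rightarrow> bool"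
  where "holomorphic_map_on f U \<longleftrightarrow>
    open U \<and> (\<forall>x\<in>U. \<exists>A :: complex ^ 'n ^ 'm. (f has_derivative (\<lambda>h. A *v h)) (at x))"

definition A_surface :: "nat \<Rightarrow> (complex ^ 3) set"
  where "A_surface n = {v. (v $ 1)\<^sup>2 + (v $ 2)\<^sup>2 + (v $ 3) ^ (n + 1) = 0}"

text \<open>The germ of \<open>V\<close> at \<open>x\<close> is isomorphic, as a germ of analytic sets, to the germ of
  \<^term>\<open>A_surface n\<close> at the origin.\<close>

definition singularity_of_type_A :: "nat \<Rightarrow> (complex ^ 'n::finite) set \<Rightarrow> complex ^ 'n \<Rightarrow> bool"
  where "singularity_of_type_A n V x \<longleftrightarrow>
    (\<exists>U W \<phi> \<psi>. x \<in> U \<and> 0 \<in> W \<and> x \<in> V \<and> \<phi> x = 0 \<and>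
       holomorphic_map_on \<phi> U \<and> holomorphic_map_on \<psi> W \<and>
       (\<forall>y \<in> V \<inter> U. \<phi> y \<in> A_surface n \<inter> W \<and> \<psi> (\<phi> y) = y) \<and>
       (\<forall>z \<in> A_surface n \<inter> W. \<psi> z \<in> V \<inter> U \<and> \<phi> (\<psi> z) = z))"


section \<open>The monodromy space\<close>

text \<open>A point of this affine space is a triple of two by two matrices; the index \<open>(k, i, j)\<close>
  is the entry \<open>(i, j)\<close> of the \<open>k\<close>-th matrix.\<close>

type_synonym triple = "complex ^ (3 \<times> 2 \<times> 2)"

definition M0 :: "triple \<Rightarrow> complex ^ 2 ^ 2"
  where "M0 T = (\<chi> i j. T $ (1, i, j))"

definition M1 :: "triple \<Rightarrow> complex ^ 2 ^ 2"
  where "M1 T = (\<chi> i j. T $ (2, i, j))"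

definition Minf :: "triple \<Rightarrow> complex ^ 2 ^ 2"
  where "Minf T = (\<chi> i j. T $ (3, i, j))"

definition mat2 :: "complex \<Rightarrow> complex \<Rightarrow> complex \<Rightarrow> complex \<Rightarrow> complex ^ 2 ^ 2"
  where "mat2 a b c d = vector [vector [a, b], vector [c, d]]"

definition Minf_matrix :: "complex \<Rightarrow> complex ^ 2 ^ 2"
  where "Minf_matrix e = mat2 0 (-1) 1 0 ** mat2 1 0 e 1"

definition monodromy_space :: "triple set"
  where "monodromy_space =
    {T. det (M0 T) = 1 \<and> det (M1 T) = 1 \<and> (\<exists>e. Minf T = Minf_matrix e) \<and>
        M0 T ** M1 T ** Minf T = mat 1}"

definition stokes :: "triple \<Rightarrow> complex"
  where "stokes T = (THE e. Minf T = Minf_matrix e)"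

lemma Minf_matrix_eq_iff: "Minf_matrix e = Minf_matrix e' \<longleftrightarrow> e = e'"
  by (auto simp: Minf_matrix_def mat2_def matrix_matrix_mult_def vec_eq_iff forall_2 sum_2)

lemma stokes_eq: "Minf T = Minf_matrix e \<Longrightarrow> stokes T = e"
  unfolding stokes_def by (auto simp: Minf_matrix_eq_iff)

text \<open>The functions \<open>x\<^sub>1, x\<^sub>2, x\<^sub>3, s\<^sub>0, s\<^sub>1\<close>, in this order.\<close>

definition coords :: "triple \<Rightarrow> complex ^ 5"
  where "coords T = vector [- (M1 T $ 1 $ 2), - (M1 T $ 1 $ 1), - stokes T, trace (M0 T), trace (M1 T)]"

definition fibre_coords :: "triple \<Rightarrow> complex ^ 3"
  where "fibre_coords T = vector [- (M1 T $ 1 $ 2), - (M1 T $ 1 $ 1), - stokes T]"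

definition family_poly :: "5 mpoly"
  where "family_poly =
    Var 1 * Var 2 * Var 3 + Var 1 ^ 2 + Var 2 ^ 2 + Var 4 * Var 1 + Var 5 * Var 2 + 1"

definition cubic :: "complex \<Rightarrow> complex \<Rightarrow> 3 mpoly"
  where "cubic s0 s1 =
    Var 1 * Var 2 * Var 3 + Var 1 ^ 2 + Var 2 ^ 2 + Const s0 * Var 1 + Const s1 * Var 2 + 1"

definition fibre :: "complex \<Rightarrow> complex \<Rightarrow> triple set"
  where "fibre s0 s1 = {T \<in> monodromy_space. trace (M0 T) = s0 \<and> trace (M1 T) = s1}"

end

(*
The product relation determines all three matrices from M1 and e, so the monodromy space is the
graph of a polynomial map over det M1 = 1; eliminating c1 and d1 by means of the traces turns it,
and likewise every fibre, into the graph of a polynomial map over the given cubic.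

The cubic f is linear in x3, with leading coefficient x1 x2. Pseudo-division by f shows that a
polynomial p vanishing on f = 0 satisfies: f divides (x1 x2)^N p. Since f does not vanish
identically on x1 = 0 or on x2 = 0, f divides p. This gives the coordinate rings, and it reduces
non-singularity to the non-vanishing of the gradient of f.

If s1 = 2t with t^2 = 1, then f = x1 w + (x2 + t)^2 with w = x2 x3 + x1 + s0, which is the normal
form of an A1 singularity in the coordinates x1, w, x2 + t. The case s0 = 2t is symmetric.
*)

theory Submission
  imports Defs
begin

section \<open>Polynomials\<close>

text \<open>Non-singularity is defined through ideals of the polynomial ring in all twelve matrix
  entries. The gradient criterion is therefore needed for a hypersurface embedded as a graph, and
  the locale \<open>hypersurface_graph\<close> supplies it by means of a polynomial retraction. It
  is used with two different projections: the whole space lies over the quadric a d - b c = 1, whose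
  gradient visibly never vanishes there, while a fibre lies over the cubic in a, b and
  \<open>T $ i\<^sub>e\<close>.

  Cancelling x1 or x2 is possible because setting that variable to 0 maps into an integral domain in
  which f stays nonzero: its value at the origin is 1. No factorization theory enters.

  On the signs: \<open>T $ i\<^sub>e\<close>, the upper left entry of \<open>Minf\<close>, is minus
  the Stokes parameter and thus equals x3, whereas x1 and x2 are negatives of entries of
  \<open>M1\<close>. Hence the traces appear with opposite signs when the cubic is written in matrix
  entries.\<close>

lemma update_eq_add_single:
  fixes p :: "'a \<Rightarrow>\<^sub>0 'b::comm_monoid_add"
  assumes "a \<notin> Poly_Mapping.keys p"
  shows "Poly_Mapping.update a b p = p + Poly_Mapping.single a b"
  using assms by (intro poly_mapping_eqI)
    (auto simp: lookup_update lookup_add lookup_single when_def in_keys_iff)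

lemma single_Var_power: "Poly_Mapping.single (Poly_Mapping.single i k) 1 = Var i ^ k"
proof (induction k)
  case (Suc k)
  have "Poly_Mapping.single i (Suc k) = Poly_Mapping.single i 1 + Poly_Mapping.single i k"
    by (simp flip: single_add)
  then show ?case by (simp add: Var_def mult_single Suc [unfolded Var_def, symmetric] del: One_nat_def)
qed simp

text \<open>A term \<open>single m c\<close> is a constant times powers of variables, so properties
  stable under sums and products need no analysis of supports.\<close>

lemma mpoly_induct [case_names Const Var add mult]:
  fixes p :: "'n mpoly"
  assumes Const: "\<And>c. P (Const c)" and Var: "\<And>i. P (Var i)"
    and add: "\<And>p q. P p \<Longrightarrow> P q \<Longrightarrow> P (p + q)"
    and mult: "\<And>p q. P p \<Longrightarrow> P q \<Longrightarrow> P (p * q)"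
  shows "P p"
proof -
  have one: "P 1" using Const[of 1] by (simp add: Const_def)
  have pow: "P (Var i ^ k)" for i k
    by (induction k) (use one mult Var in auto)
  have mono: "P (Poly_Mapping.single m c)" for m c
  proof (induction m rule: update_induct)
    case const
    then show ?case using Const[of c] by (simp add: Const_def)
  next
    case (update m a b)
    have "Poly_Mapping.single (Poly_Mapping.update a b m) c =
        Poly_Mapping.single m c * Poly_Mapping.single (Poly_Mapping.single a b) 1"
      using update by (simp add: update_eq_add_single mult_single)
    then show ?case using update by (auto simp: single_Var_power intro: mult pow)
  qed
  show ?thesis
  proof (induction p rule: update_induct)
    case const
    then show ?case using Const[of 0] by (simp add: Const_def)
  next
    case (update p a b)
    then show ?case by (auto simp: update_eq_add_single intro: add mono)
  qed
qed

section \<open>Evaluation as a ring homomorphism\<close>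

definition monom_eval :: "('n::finite \<Rightarrow>\<^sub>0 nat) \<Rightarrow> complex ^ 'n \<Rightarrow> complex"
  where "monom_eval m x = (\<Prod>i\<in>UNIV. (x $ i) ^ Poly_Mapping.lookup m i)"

lemma monom_eval_0 [simp]: "monom_eval 0 x = 1"
  by (simp add: monom_eval_def)

lemma monom_eval_add: "monom_eval (m + m') x = monom_eval m x * monom_eval m' x"
  by (simp add: monom_eval_def lookup_add power_add prod.distrib)

text \<open>The freedom in \<open>S\<close> allows several polynomials to be evaluated over one
  common index set.\<close>

lemma peval_conv_sum:
  assumes "finite S" "Poly_Mapping.keys p \<subseteq> S"
  shows "peval p x = (\<Sum>m\<in>S. Poly_Mapping.lookup p m * monom_eval m x)"
  unfolding peval_def monom_eval_def using assms
  by (intro sum.mono_neutral_left) (auto simp: in_keys_iff)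

lemma peval_single [simp]: "peval (Poly_Mapping.single m c) x = c * monom_eval m x"
  \<comment> \<open>The index set \<open>{m}\<close> also covers \<open>c = 0\<close>, where the
    support is empty.\<close>
  by (subst peval_conv_sum[of "{m}"]) auto

lemma peval_add [simp]: "peval (p + q) x = peval p x + peval q x"
proof -
  let ?S = "Poly_Mapping.keys p \<union> Poly_Mapping.keys q"
  have "peval (p + q) x = (\<Sum>m\<in>?S. Poly_Mapping.lookup (p + q) m * monom_eval m x)"
    using keys_add[of p q] by (intro peval_conv_sum) auto
  also have "\<dots> = peval p x + peval q x"
    by (subst (1 2) peval_conv_sum[of ?S]) (auto simp: lookup_add distrib_right sum.distrib)
  finally show ?thesis .
qed

lemma peval_0 [simp]: "peval 0 x = 0"
  by (simp add: peval_def)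

lemma peval_neq_0D: "peval p x \<noteq> 0 \<Longrightarrow> p \<noteq> 0"
  by auto

lemma peval_Const [simp]: "peval (Const c) x = c"
  by (simp add: Const_def)

lemma peval_Var [simp]: "peval (Var i) x = x $ i"
proof -
  have "monom_eval (Poly_Mapping.single i 1) x = (\<Prod>j\<in>UNIV. if j = i then x $ i else 1)"
    unfolding monom_eval_def by (intro prod.cong) (auto simp: lookup_single when_def)
  then show ?thesis by (simp add: Var_def)
qed

lemma peval_single_mult:
  "peval (Poly_Mapping.single m c * q) x = c * monom_eval m x * peval q x"
proof (induction q rule: update_induct)
  case (update q a b)
  then show ?case
    by (simp add: update_eq_add_single distrib_left mult_single monom_eval_add)
qed simp

lemma peval_mult [simp]: "peval (p * q) x = peval p x * peval q x"
proof (induction p rule: update_induct)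
  case (update p a b)
  then show ?case
    by (simp add: update_eq_add_single distrib_right peval_single_mult)
qed simp

lemma peval_1 [simp]: "peval 1 x = 1"
  using peval_Const[of 1 x] by (simp add: Const_def del: peval_Const)

lemma peval_uminus [simp]: "peval (- p) x = - peval p x"
  using peval_add[of p "- p" x] by (simp add: eq_neg_iff_add_eq_0 add.commute del: peval_add)

lemma peval_diff [simp]: "peval (p - q) x = peval p x - peval q x"
  using peval_add[of p "- q" x] by simp

lemma peval_power [simp]: "peval (p ^ k) x = peval p x ^ k"
  by (induction k) auto

lemma peval_sum [simp]: "peval (sum p S) x = (\<Sum>i\<in>S. peval (p i) x)"
  by (induction S rule: infinite_finite_induct) auto

lemma peval_prod [simp]: "peval (prod p S) x = (\<Prod>i\<in>S. peval (p i) x)"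
  by (induction S rule: infinite_finite_induct) auto

text \<open>Monomials are distinct characters of the multiplicative monoid of vectors, so they are
  linearly independent by the argument of Dedekind and Artin.\<close>

lemma monom_eval_independent:
  assumes "finite S" "\<And>x. (\<Sum>m\<in>S. c m * monom_eval m x) = 0" "m \<in> S"
  shows "c m = 0"
  using assms
proof (induction S arbitrary: c m rule: finite_induct)
  case empty
  then show ?case by simp
next
  case (insert a S)
  have mult: "monom_eval m (\<chi> i. x $ i * y $ i) = monom_eval m x * monom_eval m y"
    for m x and y :: "complex ^ 'a"
    by (simp add: monom_eval_def power_mult_distrib prod.distrib)
  have S: "c m = 0" if m: "m \<in> S" for m
  proof -
    from m insert.hyps(2) have "m \<noteq> a" by blast
    then have "\<exists>i. Poly_Mapping.lookup m i \<noteq> Poly_Mapping.lookup a i"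
      by (rule contrapos_np) (rule poly_mapping_eqI, simp)
    then obtain i where i: "Poly_Mapping.lookup m i \<noteq> Poly_Mapping.lookup a i" ..
    \<comment> \<open>Stretching the coordinate \<open>i\<close> by 2 separates the characters of
      \<open>m\<close> and \<open>a\<close>, since powers of 2 with distinct exponents
      differ.\<close>
    define y :: "complex ^ 'a" where "y = (\<chi> j. if j = i then 2 else 1)"
    have ev: "monom_eval m' y = 2 ^ Poly_Mapping.lookup m' i" for m'
    proof -
      have "monom_eval m' y = (\<Prod>j\<in>UNIV. if j = i then 2 ^ Poly_Mapping.lookup m' i else 1)"
        unfolding monom_eval_def y_def by (intro prod.cong) auto
      then show ?thesis by simp
    qed
    \<comment> \<open>The relation at the product of \<open>x\<close> and \<open>y\<close>, minus
      \<open>monom_eval a y\<close> times the relation at \<open>x\<close>, no longer contains the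
      term of \<open>a\<close>.\<close>
    have "(\<Sum>m\<in>S. (c m * (monom_eval m y - monom_eval a y)) * monom_eval m x) = 0" for x
    proof -
      have 1: "c a * monom_eval a x + (\<Sum>m\<in>S. c m * monom_eval m x) = 0"
        using insert.prems(1)[of x] insert.hyps by simp
      have 2: "c a * (monom_eval a x * monom_eval a y)
          + (\<Sum>m\<in>S. c m * (monom_eval m x * monom_eval m y)) = 0"
        using insert.prems(1)[of "\<chi> i. x $ i * y $ i"] insert.hyps by (simp add: mult)
      have "(\<Sum>m\<in>S. (c m * (monom_eval m y - monom_eval a y)) * monom_eval m x)
          = (\<Sum>m\<in>S. c m * (monom_eval m x * monom_eval m y))
            - monom_eval a y * (\<Sum>m\<in>S. c m * monom_eval m x)"
        by (simp add: sum_distrib_left algebra_simps flip: sum_subtractf)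
      also have "\<dots> = (c a * (monom_eval a x * monom_eval a y)
          + (\<Sum>m\<in>S. c m * (monom_eval m x * monom_eval m y)))
          - monom_eval a y * (c a * monom_eval a x + (\<Sum>m\<in>S. c m * monom_eval m x))"
        by (simp add: algebra_simps)
      finally show ?thesis by (simp only: 1 2) simp
    qed
    then have "c m * (monom_eval m y - monom_eval a y) = 0"
      using m by (rule insert.IH)
    moreover have "(2::complex) ^ k \<noteq> 2 ^ l" if "k \<noteq> l" for k l
    proof
      assume "(2::complex) ^ k = 2 ^ l"
      then have "of_nat (2 ^ k) = (of_nat (2 ^ l) :: complex)" by simp
      then show False using that unfolding of_nat_eq_iff by simp
    qed
    ultimately show ?thesis using i by (simp add: ev)
  qed
  moreover have "c a = 0"
    using insert.prems(1)[of "\<chi> i. 1"] insert.hyps S by (simp add: monom_eval_def)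
  ultimately show ?case using insert.prems by auto
qed

text \<open>From here on identities of polynomials may be checked pointwise.\<close>

lemma peval_eqD:
  assumes "\<And>x. peval p x = peval q x"
  shows "p = q"
proof -
  have "Poly_Mapping.lookup (p - q) m = 0" for m
  proof (cases "m \<in> Poly_Mapping.keys (p - q)")
    case True
    have "(\<Sum>m\<in>Poly_Mapping.keys (p - q). Poly_Mapping.lookup (p - q) m * monom_eval m x) = 0" for x
      using peval_conv_sum[of _ "p - q" x, OF finite_keys order_refl] peval_diff[of p q x] assms[of x]
      by simp
    from monom_eval_independent[OF finite_keys this True] show ?thesis .
  qed (simp add: in_keys_iff)
  then have "p - q = 0" by (intro poly_mapping_eqI) simp
  then show ?thesis by simp
qed

section \<open>Restriction to lines and absence of zero divisors\<close>

lemma peval_line: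
  obtains u where "\<And>t. peval p (x + t *s y) = poly u t"
proof -
  have "\<exists>u. \<forall>t. peval p (x + t *s y) = poly u t"
  proof (induction p rule: mpoly_induct)
    case (Const c)
    show ?case by (intro exI[of _ "[:c:]"]) simp
  next
    case (Var i)
    show ?case by (intro exI[of _ "[:x $ i, y $ i:]"]) simp
  next
    case (add p q)
    then obtain u v where "\<forall>t. peval p (x + t *s y) = poly u t" "\<forall>t. peval q (x + t *s y) = poly v t"
      by blast
    then show ?case by (intro exI[of _ "u + v"]) simp
  next
    case (mult p q)
    then obtain u v where "\<forall>t. peval p (x + t *s y) = poly u t" "\<forall>t. peval q (x + t *s y) = poly v t"
      by blast
    then show ?case by (intro exI[of _ "u * v"]) simp
  qed
  then show ?thesis using that by blast
qed

text \<open>On the line through a point where \<open>p\<close> is nonzero and a point where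
  \<open>q\<close> is nonzero, both restrict to nonzero polynomials in one variable, and these have
  a nonzero product.\<close>

lemma mpoly_mult_eq_0_iff:
  fixes p q :: "'n::finite mpoly"
  shows "p * q = 0 \<longleftrightarrow> p = 0 \<or> q = 0"
proof (rule iffI, rule ccontr)
  assume 0: "p * q = 0" and "\<not> (p = 0 \<or> q = 0)"
  then obtain x y where x: "peval p x \<noteq> 0" and y: "peval q y \<noteq> 0"
    by (metis peval_0 peval_eqD)
  obtain u where u: "\<And>t. peval p (x + t *s (y - x)) = poly u t" using peval_line by blast
  obtain v where v: "\<And>t. peval q (x + t *s (y - x)) = poly v t" using peval_line by blast
  have "u \<noteq> 0" using x u[of 0] by auto
  moreover have "v \<noteq> 0" using y v[of 1] by auto
  moreover have "poly (u * v) t = 0" for t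
    using arg_cong[OF 0, of "\<lambda>r. peval r (x + t *s (y - x))"] by (simp only: peval_mult u v peval_0 poly_mult)
  then have "u * v = 0" by (metis poly_all_0_iff_0)
  ultimately show False by simp
qed auto

lemma mpoly_mult_left_cancel:
  fixes p q r :: "'n::finite mpoly"
  shows "p \<noteq> 0 \<Longrightarrow> p * q = p * r \<longleftrightarrow> q = r"
  using mpoly_mult_eq_0_iff[of p "q - r"] by (simp add: right_diff_distrib)

subsection \<open>Substitution\<close>

definition psubst :: "('m::finite \<Rightarrow> 'n::finite mpoly) \<Rightarrow> 'm mpoly \<Rightarrow> 'n mpoly"
  where "psubst g p = (\<Sum>m\<in>Poly_Mapping.keys p.
    Const (Poly_Mapping.lookup p m) * (\<Prod>i\<in>UNIV. g i ^ Poly_Mapping.lookup m i))"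

text \<open>Together with \<open>peval_eqD\<close> this reduces the homomorphism laws of
  \<open>psubst\<close> to those of evaluation.\<close>

lemma peval_psubst [simp]: "peval (psubst g p) x = peval p (\<chi> i. peval (g i) x)"
  by (simp add: psubst_def) (simp add: peval_def)

lemma psubst_Const [simp]: "psubst g (Const c) = Const c"
  by (rule peval_eqD) simp

lemma psubst_Var [simp]: "psubst g (Var i) = g i"
  by (rule peval_eqD) simp

lemma psubst_add [simp]: "psubst g (p + q) = psubst g p + psubst g q"
  by (rule peval_eqD) simp

lemma psubst_mult [simp]: "psubst g (p * q) = psubst g p * psubst g q"
  by (rule peval_eqD) simp

subsection \<open>Ideals\<close>

lemma poly_ring_simps [simp]:
  "carrier poly_ring = UNIV" "p \<otimes>\<^bsub>poly_ring\<^esub> q = p * q" "\<one>\<^bsub>poly_ring\<^esub> = 1"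
  "\<zero>\<^bsub>poly_ring\<^esub> = 0" "p \<oplus>\<^bsub>poly_ring\<^esub> q = p + q"
  by (simp_all add: poly_ring_def)

interpretation poly_ring: cring poly_ring
  by (rule cring_poly_ring)

lemma poly_ring_a_inv [simp]: "\<ominus>\<^bsub>poly_ring\<^esub> p = - p"
  by (rule poly_ring.minus_equality) auto

lemma PIdl_poly_ring: "PIdl\<^bsub>poly_ring\<^esub> f = {p. f dvd p}"
  by (auto simp: cgenideal_def dvd_def mult.commute)

lemma Idl_poly_ring_mult: "p \<in> Idl\<^bsub>poly_ring\<^esub> G \<Longrightarrow> q * p \<in> Idl\<^bsub>poly_ring\<^esub> G"
  using ideal.I_l_closed[OF poly_ring.genideal_ideal[of G], of p q] by auto

lemma Idl_poly_ring_add: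
  "p \<in> Idl\<^bsub>poly_ring\<^esub> G \<Longrightarrow> q \<in> Idl\<^bsub>poly_ring\<^esub> G \<Longrightarrow> p + q \<in> Idl\<^bsub>poly_ring\<^esub> G"
  using additive_subgroup.a_closed[OF ideal.axioms(1)[OF poly_ring.genideal_ideal[of G]], of p q] by auto

lemma Idl_poly_ring_zero: "0 \<in> Idl\<^bsub>poly_ring\<^esub> G"
  using additive_subgroup.zero_closed[OF ideal.axioms(1)[OF poly_ring.genideal_ideal[of G]]] by auto

lemma Idl_poly_ring_base: "p \<in> G \<Longrightarrow> p \<in> Idl\<^bsub>poly_ring\<^esub> G"
  using poly_ring.genideal_self[of G] by auto

text \<open>The linear combinations of \<open>G\<close> form an ideal containing \<open>G\<close>,
  and the generated ideal is the least such ideal.\<close>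

lemma Idl_poly_ring_finiteE:
  assumes "finite G" "p \<in> Idl\<^bsub>poly_ring\<^esub> G"
  obtains c where "p = (\<Sum>g\<in>G. c g * g)"
proof -
  let ?I = "{p. \<exists>c. p = (\<Sum>g\<in>G. c g * g)}"
  have "ideal ?I poly_ring"
  proof (rule idealI)
    show "ring (poly_ring :: 'a mpoly ring)" by (rule poly_ring.ring_axioms)
    have mult: "r * p \<in> ?I" if p: "p \<in> ?I" for p r
    proof -
      from p obtain c where "p = (\<Sum>g\<in>G. c g * g)" by blast
      then have "r * p = (\<Sum>g\<in>G. (r * c g) * g)" by (simp add: sum_distrib_left mult.assoc)
      then show ?thesis by auto
    qed
    show "subgroup ?I (add_monoid poly_ring)"
    proof (rule group.subgroupI)
      show "group (add_monoid (poly_ring :: 'a mpoly ring))" by (rule poly_ring.a_group)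
      have "0 = (\<Sum>g\<in>G. 0 * g)" by simp
      then show "?I \<noteq> {}" by blast
      show "inv\<^bsub>add_monoid poly_ring\<^esub> a \<in> ?I" if "a \<in> ?I" for a
        using mult[OF that, of "-1"] poly_ring_a_inv[of a] unfolding a_inv_def by simp
      show "a \<otimes>\<^bsub>add_monoid poly_ring\<^esub> b \<in> ?I" if "a \<in> ?I" "b \<in> ?I" for a b
      proof -
        from that obtain c d where "a = (\<Sum>g\<in>G. c g * g)" "b = (\<Sum>g\<in>G. d g * g)" by blast
        then have "a + b = (\<Sum>g\<in>G. (c g + d g) * g)" by (simp add: distrib_right sum.distrib)
        then show ?thesis by auto
      qed
    qed simp
    show "x \<otimes>\<^bsub>poly_ring\<^esub> a \<in> ?I" if "a \<in> ?I" for a x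
      using mult[OF that, of x] by simp
    show "a \<otimes>\<^bsub>poly_ring\<^esub> x \<in> ?I" if "a \<in> ?I" for a x
      using mult[OF that, of x] by (simp add: mult.commute)
  qed
  moreover have "G \<subseteq> ?I"
  proof
    fix g assume "g \<in> G"
    then have "g = (\<Sum>h\<in>G. (if h = g then 1 else 0) * h)"
      using assms(1) by (simp add: if_distrib[of "\<lambda>c. c * _"] cong: if_cong)
    then show "g \<in> ?I" by (intro CollectI exI)
  qed
  ultimately have "Idl\<^bsub>poly_ring\<^esub> G \<subseteq> ?I" by (rule poly_ring.genideal_minimal)
  then show ?thesis using assms(2) that by blast
qed

text \<open>Modulo the ideal each variable is congruent to its substitute, and congruence respects
  sums and products. This is how variables are eliminated below.\<close>

lemma diff_psubst_in_Idl:
  assumes "\<And>i. Var i - g i \<in> Idl\<^bsub>poly_ring\<^esub> G"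
  shows "p - psubst g p \<in> Idl\<^bsub>poly_ring\<^esub> G"
proof (induction p rule: mpoly_induct)
  case (Const c)
  then show ?case by (simp add: Idl_poly_ring_zero)
next
  case (Var i)
  then show ?case by (simp add: assms)
next
  case (add p q)
  have "p + q - psubst g (p + q) = (p - psubst g p) + (q - psubst g q)" by simp
  then show ?case using Idl_poly_ring_add[OF add] by (simp only:)
next
  case (mult p q)
  have "p * q - psubst g (p * q) = q * (p - psubst g p) + psubst g p * (q - psubst g q)"
    by (simp add: algebra_simps)
  then show ?case using mult by (auto intro!: Idl_poly_ring_add Idl_poly_ring_mult)
qed

subsection \<open>Gradients\<close>

text \<open>Since \<open>gradient\<close> is built from \<open>deriv\<close>, its sum and product
  rules require differentiability along coordinate lines.\<close>

lemma peval_field_differentiable: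
  "(\<lambda>t. peval p (x + t *s y)) field_differentiable at t"
  by (rule peval_line[of p x y]) (auto intro: poly_DERIV simp: field_differentiable_def)

lemma gradient_Const [simp]: "gradient (Const c) x = 0"
  by (simp add: gradient_def vec_eq_iff)

lemma gradient_0 [simp]: "gradient 0 x = 0"
  by (simp add: gradient_def vec_eq_iff)

lemma gradient_1 [simp]: "gradient 1 x = 0"
  by (simp add: gradient_def vec_eq_iff)

lemma gradient_Var [simp]: "gradient (Var i) x = axis i 1"
proof -
  have "deriv (\<lambda>t. x $ i + t * c) 0 = c" for c
    by (rule DERIV_imp_deriv) (auto intro!: derivative_eq_intros)
  then show ?thesis by (auto simp: gradient_def vec_eq_iff axis_def)
qed

lemma gradient_add [simp]: "gradient (p + q) x = gradient p x + gradient q x"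
  by (simp add: gradient_def vec_eq_iff deriv_add peval_field_differentiable)

lemma gradient_mult [simp]:
  "gradient (p * q) x = peval p x *s gradient q x + peval q x *s gradient p x"
  by (simp add: gradient_def vec_eq_iff deriv_mult peval_field_differentiable mult.commute)

lemma gradient_uminus [simp]: "gradient (- p) x = - gradient p x"
  using gradient_add[of p "- p" x] by (simp add: eq_neg_iff_add_eq_0 add.commute del: gradient_add)

lemma gradient_diff [simp]: "gradient (p - q) x = gradient p x - gradient q x"
  using gradient_add[of p "- q" x] by simp

lemma gradient_sum [simp]: "gradient (sum p S) x = (\<Sum>i\<in>S. gradient (p i) x)"
  by (induction S rule: infinite_finite_induct) auto

lemma gradient_power2 [simp]: "gradient (p ^ 2) x = (2 * peval p x) *s gradient p x"
  by (simp add: power2_eq_square vec_eq_iff)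

lemma gradient_component_eq_0:
  assumes "\<And>t. peval p (x + t *s axis i 1) = peval p x"
  shows "gradient p x $ i = 0"
  by (simp add: gradient_def assms)

section \<open>Equations of hypersurfaces\<close>

text \<open>Dependence is expressed by values instead of by occurring variables, so that closure
  under the ring operations is immediate from the evaluation rules.\<close>

definition depends_only_on :: "'n::finite mpoly \<Rightarrow> 'n set \<Rightarrow> bool"
  where "depends_only_on p K \<longleftrightarrow> (\<forall>x y. (\<forall>i\<in>K. x $ i = y $ i) \<longrightarrow> peval p x = peval p y)"

lemma depends_only_onD:
  "depends_only_on p K \<Longrightarrow> (\<And>i. i \<in> K \<Longrightarrow> x $ i = y $ i) \<Longrightarrow> peval p x = peval p y"
  by (auto simp: depends_only_on_def)

lemma depends_only_on_intros [intro]: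
  "depends_only_on (Const c) K"
  "depends_only_on 0 K"
  "depends_only_on 1 K"
  "i \<in> K \<Longrightarrow> depends_only_on (Var i) K"
  "depends_only_on p K \<Longrightarrow> depends_only_on q K \<Longrightarrow> depends_only_on (p + q) K"
  "depends_only_on p K \<Longrightarrow> depends_only_on q K \<Longrightarrow> depends_only_on (p - q) K"
  "depends_only_on p K \<Longrightarrow> depends_only_on q K \<Longrightarrow> depends_only_on (p * q) K"
  "depends_only_on p K \<Longrightarrow> depends_only_on (- p) K"
  "depends_only_on p K \<Longrightarrow> depends_only_on (p ^ n) K"
  unfolding depends_only_on_def by (simp; metis)+

lemma gradient_eq_0_of_depends_only_on:
  assumes "depends_only_on p K" "i \<notin> K"
  shows "gradient p x $ i = 0"
  by (rule gradient_component_eq_0, rule depends_only_onD[OF assms(1)])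
     (use assms(2) in \<open>auto simp: axis_def\<close>)

text \<open>By the Nullstellensatz this amounts to the principal ideal of \<open>f\<close> being
  radical. In this form it can be proved directly by division.\<close>

definition reduced_equation :: "'n::finite mpoly \<Rightarrow> bool"
  where "reduced_equation f \<longleftrightarrow> (\<forall>p. (\<forall>x. peval f x = 0 \<longrightarrow> peval p x = 0) \<longrightarrow> f dvd p)"

text \<open>Substituting 0 for the variable kills \<open>p\<close> and changes it only by a multiple
  of that variable.\<close>

lemma Var_dvd:
  assumes "\<And>x. x $ i = 0 \<Longrightarrow> peval p x = 0"
  shows "Var i dvd p"
proof -
  define g where "g j = (if j = i then 0 else Var j)" for j
  have "psubst g p = 0"
    by (rule peval_eqD) (simp add: assms g_def)
  moreover have "Var j - g j \<in> Idl\<^bsub>poly_ring\<^esub> {Var i}" for j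
    by (auto simp: g_def intro: Idl_poly_ring_base Idl_poly_ring_zero)
  then have "p - psubst g p \<in> Idl\<^bsub>poly_ring\<^esub> {Var i}"
    by (rule diff_psubst_in_Idl)
  ultimately obtain c where "p = (\<Sum>q\<in>{Var i}. c q * q)"
    using Idl_poly_ring_finiteE[of "{Var i}" p] by auto
  then show ?thesis by simp
qed

text \<open>In \<open>Var i * u = f * q\<close>, substitute 0 for the variable. The left side
  vanishes while \<open>f\<close> does not, as \<open>y\<close> testifies, so \<open>q\<close>
  becomes 0 and is divisible by \<open>Var i\<close>.\<close>

lemma dvd_Var_mult_cancel:
  assumes "f dvd Var i * u" "y $ i = 0" "peval f y \<noteq> 0"
  shows "f dvd u"
proof -
  from assms(1) obtain q where q: "Var i * u = f * q" by blast
  define g where "g j = (if j = i then 0 else Var j)" for j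
  have "psubst g f * psubst g q = psubst g (Var i * u)" by (simp add: q)
  also have "\<dots> = 0" by (simp add: g_def)
  finally have "psubst g f = 0 \<or> psubst g q = 0" by (simp add: mpoly_mult_eq_0_iff)
  moreover have "psubst g f \<noteq> 0"
  proof
    assume "psubst g f = 0"
    then have "peval (psubst g f) y = 0" by simp
    moreover have "(\<chi> j. peval (g j) y) = y"
      using assms(2) by (auto simp: vec_eq_iff g_def)
    ultimately show False using assms(3) by simp
  qed
  ultimately have *: "peval (psubst g q) x = 0" for x by simp
  have "Var i dvd q"
  proof (rule Var_dvd)
    fix x :: "complex ^ 'a" assume "x $ i = 0"
    then have "(\<chi> j. peval (g j) x) = x" by (auto simp: vec_eq_iff g_def)
    then show "peval q x = 0" using *[of x] by simp
  qed
  then obtain r where "q = Var i * r" by blast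
  with q have "Var i * u = Var i * (f * r)" by (simp add: ac_simps)
  moreover have "Var i \<noteq> (0 :: 'a mpoly)"
  proof
    assume "Var i = (0 :: 'a mpoly)"
    then have "peval (Var i) (\<chi> j. 1) = (0 :: complex)" by simp
    then show False by simp
  qed
  ultimately show ?thesis by (simp add: mpoly_mult_left_cancel)
qed

text \<open>Induction over the construction of \<open>p\<close> replaces degrees in
  \<open>Var k\<close>. The essential case is \<open>Var k\<close> itself: multiplied by
  \<open>A\<close> it leaves the remainder \<open>- B\<close>. Powers of \<open>A\<close> may be
  added freely since \<open>A\<close> does not involve \<open>k\<close>.\<close>

lemma pseudo_division:
  assumes A: "depends_only_on A (- {k})" and B: "depends_only_on B (- {k})"
  shows "\<exists>N q r. A ^ N * p = q * (A * Var k + B) + r \<and> depends_only_on r (- {k})"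
proof (induction p rule: mpoly_induct)
  case (Const c)
  show ?case by (intro exI[of _ 0] exI[of _ "Const c"]) auto
next
  case (Var i)
  show ?case
  proof (cases "i = k")
    case True
    have "A ^ 1 * Var i = 1 * (A * Var k + B) + (- B)" using True by simp
    then show ?thesis using B by blast
  next
    case False
    show ?thesis by (rule exI[of _ 0], rule exI[of _ 0], rule exI[of _ "Var i"]) (use False in auto)
  qed
next
  case (add p p')
  then obtain N q r N' q' r' where
    eq: "A ^ N * p = q * (A * Var k + B) + r" "A ^ N' * p' = q' * (A * Var k + B) + r'" and
    dep: "depends_only_on r (- {k})" "depends_only_on r' (- {k})" by blast
  have "A ^ (N + N') * (p + p') = A ^ N' * (A ^ N * p) + A ^ N * (A ^ N' * p')"
    by (simp add: power_add algebra_simps)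
  also have "\<dots> = (A ^ N' * q + A ^ N * q') * (A * Var k + B) + (A ^ N' * r + A ^ N * r')"
    unfolding eq by (simp add: algebra_simps)
  finally show ?case using dep A by blast
next
  case (mult p p')
  then obtain N q r N' q' r' where
    eq: "A ^ N * p = q * (A * Var k + B) + r" "A ^ N' * p' = q' * (A * Var k + B) + r'" and
    dep: "depends_only_on r (- {k})" "depends_only_on r' (- {k})" by blast
  have "A ^ (N + N') * (p * p') = (A ^ N * p) * (A ^ N' * p')"
    by (simp add: power_add algebra_simps)
  also have "\<dots> = (q * (q' * (A * Var k + B) + r') + q' * r) * (A * Var k + B) + r * r'"
    unfolding eq by (simp add: algebra_simps)
  finally show ?case using dep by blast
qed

lemma reduced_equation_linear:
  assumes A: "depends_only_on A (- {k})" "A \<noteq> 0" and B: "depends_only_on B (- {k})"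
    and f: "f = A * Var k + B"
    and cancel: "\<And>u. f dvd A * u \<Longrightarrow> f dvd u"
  shows "reduced_equation f"
  unfolding reduced_equation_def
proof (intro allI impI)
  fix p assume van: "\<forall>x. peval f x = 0 \<longrightarrow> peval p x = 0"
  obtain N q r where eq: "A ^ N * p = q * f + r" and r: "depends_only_on r (- {k})"
    using pseudo_division[OF A(1) B] f by blast
  \<comment> \<open>The factor \<open>A\<close> takes care of the points where the equation cannot
    be solved for the coordinate \<open>k\<close>.\<close>
  have "A * r = 0"
  proof (rule peval_eqD)
    fix x
    show "peval (A * r) x = peval 0 x"
    proof (cases "peval A x = 0")
      case False
      \<comment> \<open>Only the coordinate \<open>k\<close> is changed, to the solution of
        \<open>f = 0\<close>; neither \<open>A\<close>, \<open>B\<close> nor \<open>r\<close>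
        notices the change.\<close>
      define y where "y = (\<chi> i. if i = k then - peval B x / peval A x else x $ i)"
      have "peval A y = peval A x" "peval B y = peval B x" and ry: "peval r y = peval r x"
        by (rule depends_only_onD[OF A(1)] depends_only_onD[OF B] depends_only_onD[OF r];
            simp add: y_def)+
      then have "peval f y = 0" using False by (simp add: f y_def)
      moreover from this have "peval p y = 0" using van by blast
      ultimately have "peval r y = 0" using arg_cong[OF eq, of "\<lambda>p. peval p y"] by simp
      then show ?thesis by (simp add: ry)
    qed simp
  qed
  then have "r = 0" using A(2) by (simp add: mpoly_mult_eq_0_iff)
  then have "A ^ N * p = q * f" using eq by simp
  then have "f dvd A ^ N * p" by (rule dvdI[OF trans[OF _ mult.commute]])
  then show "f dvd p"
  proof (induction N)
    case (Suc N)
    then have "f dvd A * (A ^ N * p)" by (simp add: mult.assoc)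
    then have "f dvd A ^ N * p" by (rule cancel)
    then show ?case by (rule Suc.IH)
  qed simp
qed

section \<open>Coordinate rings of graphs\<close>

lemma cring_coordinate_ring: "cring (coordinate_ring V)"
proof (rule cringI)
  let ?R = "coordinate_ring V"
  have simps: "carrier ?R = (\<lambda>p. restrict (peval p) V) ` UNIV"
    "f \<otimes>\<^bsub>?R\<^esub> g = (\<lambda>x\<in>V. f x * g x)" "f \<oplus>\<^bsub>?R\<^esub> g = (\<lambda>x\<in>V. f x + g x)"
    "\<one>\<^bsub>?R\<^esub> = (\<lambda>x\<in>V. 1)" "\<zero>\<^bsub>?R\<^esub> = (\<lambda>x\<in>V. 0)" for f g
    by (auto simp: coordinate_ring_def)
  have closed: "(\<lambda>x\<in>V. 1) \<in> carrier ?R" "(\<lambda>x\<in>V. 0) \<in> carrier ?R"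
    "(\<lambda>x\<in>V. restrict (peval p) V x + restrict (peval q) V x) \<in> carrier ?R"
    "(\<lambda>x\<in>V. restrict (peval p) V x * restrict (peval q) V x) \<in> carrier ?R" for p q
    unfolding simps
    by (rule image_eqI[of _ _ 1] image_eqI[of _ _ 0] image_eqI[of _ _ "p + q"]
        image_eqI[of _ _ "p * q"]; auto)+
  show "abelian_group ?R"
  proof (rule abelian_groupI)
    fix f assume "f \<in> carrier ?R"
    then obtain p where "f = restrict (peval p) V" by (auto simp: simps)
    then show "\<exists>g\<in>carrier ?R. g \<oplus>\<^bsub>?R\<^esub> f = \<zero>\<^bsub>?R\<^esub>"
      unfolding simps by (intro bexI[of _ "restrict (peval (- p)) V"]) (auto simp: fun_eq_iff)
  qed (use closed in \<open>auto simp: simps fun_eq_iff\<close>)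
  show "comm_monoid ?R"
    by (rule comm_monoidI) (use closed in \<open>auto simp: simps fun_eq_iff\<close>)
  show "(f \<oplus>\<^bsub>?R\<^esub> g) \<otimes>\<^bsub>?R\<^esub> h = f \<otimes>\<^bsub>?R\<^esub> h \<oplus>\<^bsub>?R\<^esub> g \<otimes>\<^bsub>?R\<^esub> h" for f g h
    by (auto simp: simps fun_eq_iff distrib_right)
qed

text \<open>First isomorphism theorem for composition with \<open>\<phi>\<close>. The polynomials
  \<open>P\<close> make it land in the coordinate ring, their inverse \<open>Q\<close> makes it
  surjective, and its kernel is generated by \<open>f\<close> because \<open>\<phi>\<close> maps
  \<open>V\<close> onto the zero set of the reduced equation \<open>f\<close>.\<close>

lemma coordinate_ring_presentationI:
  fixes V :: "(complex ^ 'n::finite) set" and \<phi> :: "complex ^ 'n \<Rightarrow> complex ^ 'm::finite"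
  assumes red: "reduced_equation f"
    and \<phi>: "\<And>x i. x \<in> V \<Longrightarrow> \<phi> x $ i = peval (P i) x"
    and zero: "\<And>x. x \<in> V \<Longrightarrow> peval f (\<phi> x) = 0"
    and sec: "\<And>z. peval f z = 0 \<Longrightarrow> \<exists>x\<in>V. \<phi> x = z"
    and inv: "\<And>x i. x \<in> V \<Longrightarrow> peval (Q i) (\<phi> x) = x $ i"
  shows "coordinate_ring_presentation V \<phi> f"
proof -
  let ?R = "poly_ring :: 'm mpoly ring" and ?S = "coordinate_ring V"
  define \<eta> where "\<eta> p = (\<lambda>x\<in>V. peval p (\<phi> x))" for p
  have \<phi>_eq: "\<phi> x = (\<chi> i. peval (P i) x)" if "x \<in> V" for x
    using \<phi>[OF that] by (simp add: vec_eq_iff)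
  have "\<eta> \<in> ring_hom ?R ?S"
  proof (rule ring_hom_memI)
    fix p
    have "\<eta> p = restrict (peval (psubst P p)) V"
      by (auto simp: \<eta>_def fun_eq_iff \<phi>_eq)
    then show "\<eta> p \<in> carrier ?S" by (auto simp: coordinate_ring_def)
  qed (auto simp: \<eta>_def coordinate_ring_def fun_eq_iff)
  then interpret \<eta>: ring_hom_ring ?R ?S \<eta>
    by (intro ring_hom_ringI2 cring.axioms(1) cring_poly_ring cring_coordinate_ring)
  have surj: "\<eta> ` carrier ?R = carrier ?S"
  proof -
    have "restrict (peval p) V = \<eta> (psubst Q p)" for p
      by (auto simp: \<eta>_def fun_eq_iff inv)
    then show ?thesis using \<eta>.hom_closed by (fastforce simp: coordinate_ring_def)
  qed
  have "\<eta> p = \<zero>\<^bsub>?S\<^esub> \<longleftrightarrow> f dvd p" for p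
  proof -
    have "\<eta> p = \<zero>\<^bsub>?S\<^esub> \<longleftrightarrow> (\<forall>x\<in>V. peval p (\<phi> x) = 0)"
      by (auto simp: \<eta>_def coordinate_ring_def fun_eq_iff)
    also have "\<dots> \<longleftrightarrow> (\<forall>z. peval f z = 0 \<longrightarrow> peval p z = 0)"
      using sec zero by metis
    also have "\<dots> \<longleftrightarrow> f dvd p"
      using red by (auto simp: reduced_equation_def)
    finally show ?thesis .
  qed
  then have ker: "a_kernel ?R ?S \<eta> = PIdl\<^bsub>?R\<^esub> f"
    unfolding a_kernel_def' PIdl_poly_ring by simp
  show ?thesis
    unfolding coordinate_ring_presentation_def
  proof (intro bexI allI ballI)
    show "(\<lambda>X. the_elem (\<eta> ` X)) \<in> ring_iso (?R Quot (PIdl\<^bsub>?R\<^esub> f)) ?S"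
      using \<eta>.FactRing_iso_set[OF surj] by (simp add: ker)
    show "the_elem (\<eta> ` (PIdl\<^bsub>?R\<^esub> f +>\<^bsub>?R\<^esub> p)) x = peval p (\<phi> x)" if "x \<in> V" for p x
      using \<eta>.the_elem_simp[of p] that by (simp add: ker \<eta>_def)
  qed
qed

section \<open>Singular points of graphs over hypersurfaces\<close>

text \<open>\<open>nonsingular_at\<close> speaks of a set of generators and a set of gradients,
  whereas the relations below are naturally indexed. A coincidence of two gradients would itself be
  a relation, with coefficients 1 and -1.\<close>

lemma independent_familyI:
  fixes v :: "'a \<Rightarrow> complex ^ 'n"
  assumes "finite I" and indep: "\<And>c i. (\<Sum>i\<in>I. c i *s v (g i)) = 0 \<Longrightarrow> i \<in> I \<Longrightarrow> c i = 0"
  shows "inj_on v (g ` I)" "vec.independent (v ` g ` I)"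
proof -
  have inj: "inj_on (v \<circ> g) I"
  proof (rule inj_onI, rule ccontr)
    fix i j assume ij: "i \<in> I" "j \<in> I" "(v \<circ> g) i = (v \<circ> g) j" "i \<noteq> j"
    let ?c = "\<lambda>k. if k = i then 1 else if k = j then - 1 else (0::complex)"
    have "(\<Sum>k\<in>I. ?c k *s v (g k)) = (\<Sum>k\<in>{i, j}. ?c k *s v (g k))"
      using ij assms(1) by (intro sum.mono_neutral_right) auto
    also have "\<dots> = 0" using ij by (simp add: vec_eq_iff)
    finally have "?c i = 0" using ij(1) by (rule indep)
    then show False by simp
  qed
  then show "inj_on v (g ` I)" by (rule inj_on_imageI)
  show "vec.independent (v ` g ` I)"
    unfolding image_comp
  proof (rule vec.independent_if_scalars_zero)
    fix c w assume "(\<Sum>x\<in>(v \<circ> g) ` I. c x *s x) = 0" and w: "w \<in> (v \<circ> g) ` I"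
    then have "(\<Sum>i\<in>I. c (v (g i)) *s v (g i)) = 0"
      by (subst (asm) sum.reindex[OF inj]) simp
    from indep[OF this] w show "c w = 0" by auto
  qed (use assms(1) in simp)
qed

text \<open>The coordinates in \<open>K\<close> satisfy the single equation \<open>F\<close>; the
  others are the polynomials \<open>h\<close> in them.\<close>

locale hypersurface_graph =
  fixes K :: "'n::finite set" and h :: "'n \<Rightarrow> 'n mpoly" and F :: "'n mpoly"
  assumes h: "\<And>j. j \<notin> K \<Longrightarrow> depends_only_on (h j) K"
    and F: "depends_only_on F K" "reduced_equation F" "F \<noteq> 0"
begin

definition graph :: "(complex ^ 'n) set"
  where "graph = {x. (\<forall>j. j \<notin> K \<longrightarrow> x $ j = peval (h j) x) \<and> peval F x = 0}"

text \<open>Projection of the ambient space onto the graph of \<open>h\<close>, with no regard to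
  \<open>F\<close>.\<close>

definition retraction :: "'n \<Rightarrow> 'n mpoly"
  where "retraction j = (if j \<in> K then Var j else h j)"

abbreviation retract :: "complex ^ 'n \<Rightarrow> complex ^ 'n"
  where "retract x \<equiv> \<chi> j. peval (retraction j) x"

lemma algebraic_graph: "algebraic_set graph"
  unfolding algebraic_set_def
  by (rule exI[of _ "insert F ((\<lambda>j. Var j - h j) ` (- K))"]) (auto simp: graph_def)

lemma retract_graph: "x \<in> graph \<Longrightarrow> retract x = x"
  by (simp add: graph_def retraction_def vec_eq_iff)

lemma peval_retract: "depends_only_on p K \<Longrightarrow> peval p (retract x) = peval p x"
  by (erule depends_only_onD) (simp add: retraction_def)

lemma retract_in_graph: "peval F x = 0 \<Longrightarrow> retract x \<in> graph"
  using peval_retract[OF F(1), of x] peval_retract[OF h, of _ x]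
  by (simp add: graph_def) (simp add: retraction_def)

text \<open>The retraction sends the whole zero set of \<open>F\<close> in the ambient space into
  the graph, so the pullback of \<open>p\<close> vanishes there and reducedness applies.\<close>

lemma dvd_psubst_retraction:
  assumes "p \<in> vanishing_ideal graph"
  shows "F dvd psubst retraction p"
proof -
  have "peval (psubst retraction p) x = 0" if "peval F x = 0" for x
    using assms retract_in_graph[OF that] by (simp add: vanishing_ideal_def)
  then show ?thesis using F(2) by (auto simp: reduced_equation_def)
qed

lemma F_in_vanishing_ideal: "F \<in> vanishing_ideal graph"
  by (simp add: vanishing_ideal_def graph_def)

text \<open>The generators are \<open>F\<close> and the differences \<open>Var j - h j\<close>. They
  generate the vanishing ideal globally, so the multiplier is 1.\<close>

lemma nonsingular_at_graphI:
  assumes "gradient F x \<noteq> 0"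
  shows "nonsingular_at graph x"
proof -
  \<comment> \<open>\<open>None\<close> indexes the equation \<open>F\<close>, and
    \<open>Some j\<close> the equation for the coordinate \<open>j\<close> outside
    \<open>K\<close>.\<close>
  define g where "g = case_option F (\<lambda>j. Var j - h j)"
  let ?I = "insert None (Some ` (- K))"
  have indep: "c i = 0" if sum: "(\<Sum>i\<in>?I. c i *s gradient (g i) x) = 0" and i: "i \<in> ?I" for c i
  proof -
    have 0: "c None *s gradient F x + (\<Sum>j\<in>- K. c (Some j) *s (axis j 1 - gradient (h j) x)) = 0"
      using sum by (simp add: sum.reindex g_def)
    have Some: "c (Some j) = 0" if j: "j \<notin> K" for j
    proof -
      \<comment> \<open>The component \<open>j\<close> isolates \<open>c (Some j)\<close>: the
        gradients of \<open>F\<close> and of every \<open>h i\<close> are zero outside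
        \<open>K\<close>.\<close>
      have "0 = (c None *s gradient F x
          + (\<Sum>i\<in>- K. c (Some i) *s (axis i 1 - gradient (h i) x))) $ j"
        by (simp only: 0 zero_index)
      also have "\<dots> = (\<Sum>i\<in>- K. c (Some i) * (axis i 1 - gradient (h i) x) $ j)"
        using gradient_eq_0_of_depends_only_on[OF F(1) j] by (simp add: right_diff_distrib)
      also have "\<dots> = (\<Sum>i\<in>- K. if i = j then c (Some i) else 0)"
        using gradient_eq_0_of_depends_only_on[OF h j] by (intro sum.cong) (auto simp: axis_def)
      also have "\<dots> = c (Some j)" using j by simp
      finally show ?thesis by simp
    qed
    then have "c None *s gradient F x = 0" using 0 by simp
    then have "c None = 0" using assms by simp
    with Some i show ?thesis by auto
  qed
  have "g ` ?I \<subseteq> vanishing_ideal graph"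
    using F_in_vanishing_ideal by (auto simp: g_def vanishing_ideal_def graph_def)
  moreover have "p \<in> Idl\<^bsub>poly_ring\<^esub> (g ` ?I)" if p: "p \<in> vanishing_ideal graph" for p
  proof -
    have "Var j - h j \<in> Idl\<^bsub>poly_ring\<^esub> (g ` ?I)" if "j \<notin> K" for j
      by (rule Idl_poly_ring_base, rule image_eqI[of _ _ "Some j"]) (use that in \<open>auto simp: g_def\<close>)
    then have "p - psubst retraction p \<in> Idl\<^bsub>poly_ring\<^esub> (g ` ?I)"
      by (intro diff_psubst_in_Idl) (simp add: retraction_def Idl_poly_ring_zero)
    moreover obtain q where "psubst retraction p = q * F"
      using dvd_psubst_retraction[OF p] by (metis dvdE mult.commute)
    moreover have "F \<in> g ` ?I" by (rule image_eqI[of _ _ None]) (auto simp: g_def)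
    ultimately show ?thesis
      using Idl_poly_ring_add[of "p - psubst retraction p" "g ` ?I" "q * F"]
        Idl_poly_ring_mult[OF Idl_poly_ring_base, of F "g ` ?I" q] by simp
  qed
  moreover have "inj_on (\<lambda>p. gradient p x) (g ` ?I)"
    by (rule independent_familyI(1)) (simp, rule indep)
  moreover have "vec.independent ((\<lambda>p. gradient p x) ` g ` ?I)"
    by (rule independent_familyI(2)) (simp, rule indep)
  ultimately show ?thesis
    unfolding nonsingular_at_def
    by (intro exI[of _ "g ` ?I"] conjI ballI exI[of _ 1]) simp_all
qed

text \<open>If \<open>gradient F x = 0\<close> and \<open>u * F = (\<Sum>g\<in>G. c g * g)\<close> with independent gradients of the
  elements of \<open>G\<close>, then all \<open>c g\<close> vanish at \<open>x\<close>. On the graph of \<open>h\<close>, every \<open>g\<close> is a multiple of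
  \<open>F\<close>, so that \<open>F\<close> can be cancelled, and hence \<open>u\<close> vanishes at \<open>x\<close> as well.\<close>

lemma not_nonsingular_at_graphI:
  assumes x: "x \<in> graph" and "gradient F x = 0"
  shows "\<not> nonsingular_at graph x"
proof
  assume "nonsingular_at graph x"
  then obtain G u where G: "finite G" "G \<subseteq> vanishing_ideal graph"
    "inj_on (\<lambda>g. gradient g x) G" "vec.independent ((\<lambda>g. gradient g x) ` G)"
    and u: "peval u x \<noteq> 0" "u * F \<in> Idl\<^bsub>poly_ring\<^esub> G"
    unfolding nonsingular_at_def using F_in_vanishing_ideal by blast
  from Idl_poly_ring_finiteE[OF G(1) u(2)] obtain c where c: "u * F = (\<Sum>g\<in>G. c g * g)" .
  have zero: "peval g x = 0" if "g \<in> G" for g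
    using that G(2) x by (auto simp: vanishing_ideal_def)
  \<comment> \<open>All \<open>g\<close> vanish at \<open>x\<close>, so the product rule leaves only
    the terms with the gradients of \<open>g\<close>.\<close>
  have "(\<Sum>g\<in>G. peval (c g) x *s gradient g x) = gradient (\<Sum>g\<in>G. c g * g) x"
    by (simp add: zero)
  also have "\<dots> = 0"
    using x assms(2) by (simp flip: c add: graph_def)
  \<comment> \<open>The coefficients are reindexed by gradient vectors, as independence is a
    property of a set of vectors.\<close>
  finally have "(\<Sum>w\<in>(\<lambda>g. gradient g x) ` G.
      peval (c (the_inv_into G (\<lambda>g. gradient g x) w)) x *s w) = 0"
    by (simp add: sum.reindex[OF G(3)] the_inv_into_f_f[OF G(3)] cong: sum.cong)
  then have c0: "peval (c g) x = 0" if "g \<in> G" for g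
    using vec.independentD[OF G(4) finite_imageI[OF G(1)] order_refl,
        of "\<lambda>w. peval (c (the_inv_into G (\<lambda>g. gradient g x) w)) x", OF _ imageI[OF that]] that
    by (simp add: the_inv_into_f_f[OF G(3)])
  have "\<exists>w. \<forall>g\<in>G. psubst retraction g = F * w g"
    using dvd_psubst_retraction G(2) by (intro bchoice) (auto simp: dvd_def)
  then obtain w where w: "\<And>g. g \<in> G \<Longrightarrow> psubst retraction g = F * w g" by blast
  \<comment> \<open>The relation \<open>c\<close> is pulled back along the retraction, which leaves
    \<open>F\<close> unchanged and turns each \<open>g\<close> into \<open>F * w g\<close>.\<close>
  have "F * psubst retraction u = F * (\<Sum>g\<in>G. psubst retraction (c g) * w g)"
  proof (rule peval_eqD)
    fix y
    have "peval (F * psubst retraction u) y = peval (u * F) (retract y)"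
      by (simp add: peval_retract[OF F(1)])
    also have "\<dots> = (\<Sum>g\<in>G. peval (c g) (retract y) * peval (psubst retraction g) y)"
      by (simp add: c)
    also have "\<dots> = (\<Sum>g\<in>G. peval (c g) (retract y) * peval (F * w g) y)"
      by (intro sum.cong) (simp_all add: w del: peval_psubst)
    also have "\<dots> = peval (F * (\<Sum>g\<in>G. psubst retraction (c g) * w g)) y"
      by (simp add: sum_distrib_left ac_simps)
    finally show "peval (F * psubst retraction u) y
        = peval (F * (\<Sum>g\<in>G. psubst retraction (c g) * w g)) y" .
  qed
  then have "psubst retraction u = (\<Sum>g\<in>G. psubst retraction (c g) * w g)"
    using F(3) by (simp add: mpoly_mult_left_cancel)
  from arg_cong[OF this, of "\<lambda>p. peval p x"] have "peval u x = 0"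
    using retract_graph[OF x] by (simp add: c0)
  with u(1) show False by simp
qed

lemma singular_points_graph: "singular_points graph = {x \<in> graph. gradient F x = 0}"
  using nonsingular_at_graphI not_nonsingular_at_graphI by (auto simp: singular_points_def)

end

section \<open>Holomorphic maps and the type of a singularity\<close>

text \<open>\<open>has_derivative\<close> yields a real linear map only; commuting with complex
  scalars makes it complex linear.\<close>

definition holomorphic_at :: "(complex ^ 'n::finite \<Rightarrow> complex) \<Rightarrow> complex ^ 'n \<Rightarrow> bool"
  where "holomorphic_at g x \<longleftrightarrow>
    (\<exists>D. (g has_derivative D) (at x) \<and> (\<forall>c h. D (c *s h) = c * D h))"

lemma holomorphic_at_const: "holomorphic_at (\<lambda>_. c) x"
  unfolding holomorphic_at_def by (intro exI[of _ "\<lambda>_. 0"]) simp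

lemma holomorphic_at_nth: "holomorphic_at (\<lambda>x. x $ i) x"
  unfolding holomorphic_at_def
  by (intro exI[of _ "\<lambda>x. x $ i"]) (auto intro: bounded_linear_imp_has_derivative)

lemma holomorphic_at_add:
  assumes "holomorphic_at f x" "holomorphic_at g x"
  shows "holomorphic_at (\<lambda>x. f x + g x) x"
proof -
  obtain D E where D: "(f has_derivative D) (at x)" "(g has_derivative E) (at x)"
    "\<And>c h. D (c *s h) = c * D h" "\<And>c h. E (c *s h) = c * E h"
    using assms unfolding holomorphic_at_def by blast
  then show ?thesis unfolding holomorphic_at_def
    by (intro exI[of _ "\<lambda>h. D h + E h"]) (auto intro!: has_derivative_add simp: algebra_simps)
qed

lemma holomorphic_at_mult:
  assumes "holomorphic_at f x" "holomorphic_at g x"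
  shows "holomorphic_at (\<lambda>x. f x * g x) x"
proof -
  obtain D E where D: "(f has_derivative D) (at x)" "(g has_derivative E) (at x)"
    "\<And>c h. D (c *s h) = c * D h" "\<And>c h. E (c *s h) = c * E h"
    using assms unfolding holomorphic_at_def by blast
  show ?thesis unfolding holomorphic_at_def
    by (rule exI, rule conjI, rule has_derivative_mult[OF D(1,2)]) (simp add: D(3,4) algebra_simps)
qed

lemma holomorphic_at_divide:
  assumes "holomorphic_at f x" "holomorphic_at g x" "g x \<noteq> 0"
  shows "holomorphic_at (\<lambda>x. f x / g x) x"
proof -
  obtain D E where D: "(f has_derivative D) (at x)" "(g has_derivative E) (at x)"
    "\<And>c h. D (c *s h) = c * D h" "\<And>c h. E (c *s h) = c * E h"
    using assms unfolding holomorphic_at_def by blast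
  show ?thesis unfolding holomorphic_at_def
    by (rule exI, rule conjI, rule has_derivative_divide[OF D(1,2) assms(3)])
       (simp add: D(3,4) algebra_simps)
qed

lemma holomorphic_at_peval: "holomorphic_at (peval p) x"
proof (induction p rule: mpoly_induct)
  case (Const c)
  show ?case using holomorphic_at_const[of c x] by simp
next
  case (Var i)
  show ?case using holomorphic_at_nth[of i x] by simp
next
  case (add p q)
  show ?case using holomorphic_at_add[OF add] by simp
next
  case (mult p q)
  show ?case using holomorphic_at_mult[OF mult] by simp
qed

text \<open>A derivative is additive, so complex homogeneity suffices for it to be given by a
  complex matrix. This form is easier to compose and to assemble from components.\<close>

lemma holomorphic_map_on_iff_derivative:
  "holomorphic_map_on f U \<longleftrightarrow>
    open U \<and> (\<forall>x\<in>U. \<exists>D. (f has_derivative D) (at x) \<and> (\<forall>c h. D (c *s h) = c *s D h))"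
proof -
  have "(\<exists>A. (f has_derivative (\<lambda>h. A *v h)) (at x)) \<longleftrightarrow>
      (\<exists>D. (f has_derivative D) (at x) \<and> (\<forall>c h. D (c *s h) = c *s D h))" for x
  proof
    assume "\<exists>D. (f has_derivative D) (at x) \<and> (\<forall>c h. D (c *s h) = c *s D h)"
    then obtain D where D: "(f has_derivative D) (at x)" "\<And>c h. D (c *s h) = c *s D h" by blast
    have "Vector_Spaces.linear (*s) (*s) D"
    proof (rule Vector_Spaces.linear_iff[THEN iffD2], intro conjI allI)
      show "D (a + b) = D a + D b" for a b
        using has_derivative_bounded_linear[OF D(1)] by (simp add: bounded_linear.linear linear_add)
    qed (use D(2) in \<open>auto intro: vec.vector_space_axioms\<close>)
    then have "D = (\<lambda>h. matrix D *v h)" by (simp add: matrix_works fun_eq_iff)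
    then show "\<exists>A. (f has_derivative (\<lambda>h. A *v h)) (at x)" using D(1) by metis
  qed (metis vector_scalar_commute)
  then show ?thesis by (simp add: holomorphic_map_on_def)
qed

lemma holomorphic_map_onI:
  fixes f :: "complex ^ 'n::finite \<Rightarrow> complex ^ 'm::finite"
  assumes "open U" and f: "\<And>x i. x \<in> U \<Longrightarrow> holomorphic_at (\<lambda>x. f x $ i) x"
  shows "holomorphic_map_on f U"
  unfolding holomorphic_map_on_iff_derivative
proof (intro conjI ballI)
  fix x assume "x \<in> U"
  then have "\<forall>i. \<exists>D. ((\<lambda>x. f x $ i) has_derivative D) (at x) \<and> (\<forall>c h. D (c *s h) = c * D h)"
    using f unfolding holomorphic_at_def by blast
  then obtain D where D: "\<And>i. ((\<lambda>x. f x $ i) has_derivative D i) (at x)"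
    "\<And>i c h. D i (c *s h) = c * D i h" by metis
  have "(f has_derivative (\<lambda>h. \<chi> i. D i h)) (at x)"
    by (subst has_derivative_componentwise_within)
       (auto simp: Basis_vec_def inner_axis intro!: has_derivative_inner_left D)
  then show "\<exists>D. (f has_derivative D) (at x) \<and> (\<forall>c h. D (c *s h) = c *s D h)"
    using D(2) by (intro exI[of _ "\<lambda>h. \<chi> i. D i h"]) (simp add: vec_eq_iff)
qed fact

lemma holomorphic_map_on_3I:
  fixes f :: "complex ^ 'n::finite \<Rightarrow> complex ^ 3"
  assumes "open U" "\<And>x. x \<in> U \<Longrightarrow> holomorphic_at (\<lambda>x. f x $ 1) x"
    "\<And>x. x \<in> U \<Longrightarrow> holomorphic_at (\<lambda>x. f x $ 2) x" "\<And>x. x \<in> U \<Longrightarrow> holomorphic_at (\<lambda>x. f x $ 3) x"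
  shows "holomorphic_map_on f U"
proof (rule holomorphic_map_onI)
  fix x i assume "x \<in> U"
  then show "holomorphic_at (\<lambda>x. f x $ i) x" using assms(2-) exhaust_3[of i] by auto
qed fact

lemma holomorphic_map_on_compose:
  assumes f: "holomorphic_map_on f U" and g: "holomorphic_map_on g W"
    and "open T" "T \<subseteq> U" "f ` T \<subseteq> W"
  shows "holomorphic_map_on (\<lambda>x. g (f x)) T"
  unfolding holomorphic_map_on_iff_derivative
proof (intro conjI ballI)
  fix x assume "x \<in> T"
  then have "x \<in> U" "f x \<in> W" using assms by auto
  then obtain D E where D: "(f has_derivative D) (at x)" "\<And>c h. D (c *s h) = c *s D h"
    and E: "(g has_derivative E) (at (f x))" "\<And>c h. E (c *s h) = c *s E h"
    using f g unfolding holomorphic_map_on_iff_derivative by metis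
  have "((\<lambda>x. g (f x)) has_derivative (\<lambda>h. E (D h))) (at x)"
    using D(1) E(1) by (rule has_derivative_compose)
  then show "\<exists>D. ((\<lambda>x. g (f x)) has_derivative D) (at x) \<and> (\<forall>c h. D (c *s h) = c *s D h)"
    using D(2) E(2) by (intro exI[of _ "\<lambda>h. E (D h)"]) simp
qed fact

lemma holomorphic_map_on_imp_continuous_on: "holomorphic_map_on f U \<Longrightarrow> continuous_on U f"
  unfolding holomorphic_map_on_def
  by (metis continuous_at_imp_continuous_on has_derivative_continuous)

text \<open>The maps need to be inverse to each other only on the two sets, so the ambient
  dimensions may differ, as they do for triples and the cubic in three variables.\<close>

lemma singularity_of_type_A_transfer:
  assumes V': "singularity_of_type_A n V' (\<alpha> x)" and x: "x \<in> V"
    and hol: "holomorphic_map_on \<alpha> UNIV" "holomorphic_map_on \<beta> UNIV"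
    and \<alpha>: "\<And>y. y \<in> V \<Longrightarrow> \<alpha> y \<in> V' \<and> \<beta> (\<alpha> y) = y"
    and \<beta>: "\<And>y. y \<in> V' \<Longrightarrow> \<beta> y \<in> V \<and> \<alpha> (\<beta> y) = y"
  shows "singularity_of_type_A n V x"
proof -
  obtain U W \<phi> \<psi> where *: "\<alpha> x \<in> U" "0 \<in> W" "\<phi> (\<alpha> x) = 0"
    "holomorphic_map_on \<phi> U" "holomorphic_map_on \<psi> W"
    and \<phi>: "\<And>y. y \<in> V' \<inter> U \<Longrightarrow> \<phi> y \<in> A_surface n \<inter> W \<and> \<psi> (\<phi> y) = y"
    and \<psi>: "\<And>z. z \<in> A_surface n \<inter> W \<Longrightarrow> \<psi> z \<in> V' \<inter> U \<and> \<phi> (\<psi> z) = z"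
    using V' unfolding singularity_of_type_A_def by blast
  have "open (\<alpha> -` U)"
    using holomorphic_map_on_imp_continuous_on[OF hol(1)] *(4)
    by (auto simp: holomorphic_map_on_def intro: open_vimage)
  moreover have "open W" using *(5) by (simp add: holomorphic_map_on_def)
  ultimately have "holomorphic_map_on (\<lambda>x. \<phi> (\<alpha> x)) (\<alpha> -` U)" "holomorphic_map_on (\<lambda>z. \<beta> (\<psi> z)) W"
    using holomorphic_map_on_compose[OF hol(1) *(4)] holomorphic_map_on_compose[OF *(5) hol(2)]
    by auto
  moreover have "\<phi> (\<alpha> y) \<in> A_surface n \<inter> W \<and> \<beta> (\<psi> (\<phi> (\<alpha> y))) = y" if "y \<in> V \<inter> \<alpha> -` U" for y
    using \<phi>[of "\<alpha> y"] \<alpha>[of y] that by auto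
  moreover have "\<beta> (\<psi> z) \<in> V \<inter> \<alpha> -` U \<and> \<phi> (\<alpha> (\<beta> (\<psi> z))) = z" if "z \<in> A_surface n \<inter> W" for z
    using \<psi>[OF that] \<beta>[of "\<psi> z"] by auto
  ultimately show ?thesis
    unfolding singularity_of_type_A_def using *(1-3) x
    by (intro exI[of _ "\<alpha> -` U"] exI[of _ W] exI[of _ "\<lambda>x. \<phi> (\<alpha> x)"] exI[of _ "\<lambda>z. \<beta> (\<psi> z)"]) auto
qed

section \<open>The cubic surfaces\<close>

lemma vec3_eq_iff: "(v :: 'a ^ 3) = w \<longleftrightarrow> v $ 1 = w $ 1 \<and> v $ 2 = w $ 2 \<and> v $ 3 = w $ 3"
  by (simp add: vec_eq_iff forall_3)

definition cubic_surface :: "complex \<Rightarrow> complex \<Rightarrow> (complex ^ 3) set"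
  where "cubic_surface s0 s1 = {v. peval (cubic s0 s1) v = 0}"

lemma peval_cubic:
  "peval (cubic s0 s1) v = v $ 1 * v $ 2 * v $ 3 + (v $ 1)\<^sup>2 + (v $ 2)\<^sup>2 + s0 * v $ 1 + s1 * v $ 2 + 1"
  by (simp add: cubic_def)

text \<open>With \<open>s1 = 2 * t\<close> and \<open>t\<^sup>2 = 1\<close> the equation becomes \<open>x\<^sub>1 w + (x\<^sub>2 + t)\<^sup>2 = 0\<close>, where
  \<open>w = x\<^sub>2 x\<^sub>3 + x\<^sub>1 + s0\<close> can replace the coordinate \<open>x\<^sub>3\<close> as long as \<open>x\<^sub>2 \<noteq> 0\<close>.\<close>

lemma cubic_surface_type_A1:
  assumes "s1\<^sup>2 = 4"
  shows "singularity_of_type_A 1 (cubic_surface s0 s1) (vector [0, - s1 / 2, s0 * s1 / 2])"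
proof -
  define t where "t = s1 / 2"
  have t: "t * t = 1" "s1 = 2 * t" "t \<noteq> 0" using assms by (auto simp: t_def power2_eq_square)
  \<comment> \<open>With X = (x1 + w) / 2 and Y = (x1 - w) / (2 i) the product x1 w becomes X^2 +
    Y^2.\<close>
  define \<phi> :: "complex ^ 3 \<Rightarrow> complex ^ 3" where
    "\<phi> y = vector [(y $ 1 + (y $ 2 * y $ 3 + y $ 1 + s0)) / 2,
      (y $ 1 + (-1) * (y $ 2 * y $ 3 + y $ 1 + s0)) / (2 * \<i>), y $ 2 + t]" for y
  \<comment> \<open>Here x1 = X + i Y and w = X - i Y; the last entry solves w = x2 x3 + x1 + s0 for
    x3.\<close>
  define \<psi> :: "complex ^ 3 \<Rightarrow> complex ^ 3" where
    "\<psi> z = vector [z $ 1 + \<i> * z $ 2, z $ 3 + (- t), ((- 2) * \<i> * z $ 2 + (- s0)) / (z $ 3 + (- t))]" for z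
  let ?U = "{y :: complex ^ 3. y $ 2 \<noteq> 0}" and ?W = "{z :: complex ^ 3. z $ 3 + (- t) \<noteq> 0}"
  have open_UW: "open ?U" "open ?W"
    by (intro open_Collect_neq continuous_intros)+
  \<comment> \<open>The components above are written with sums instead of differences so that these
    rules apply directly.\<close>
  note intros = holomorphic_at_add holomorphic_at_mult holomorphic_at_divide
    holomorphic_at_const holomorphic_at_nth
  have hol: "holomorphic_map_on \<phi> ?U" "holomorphic_map_on \<psi> ?W"
    unfolding \<phi>_def \<psi>_def
    by (rule holomorphic_map_on_3I, rule open_UW; simp only: vector_3; intro intros; simp)+
  have "\<phi> y \<in> A_surface 1 \<inter> ?W \<and> \<psi> (\<phi> y) = y" if y: "y \<in> cubic_surface s0 s1 \<inter> ?U" for y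
  proof -
    have eq: "y $ 1 * (y $ 2 * y $ 3 + y $ 1 + s0) + (y $ 2 + t)\<^sup>2 = 0"
      using y t(1,2) by (simp add: cubic_surface_def peval_cubic power2_eq_square algebra_simps)
    have "((a + b) / 2)\<^sup>2 + ((a + (-1) * b) / (2 * \<i>))\<^sup>2 = a * b" for a b :: complex
      by (simp add: power2_eq_square field_simps)
    then have "(\<phi> y $ 1)\<^sup>2 + (\<phi> y $ 2)\<^sup>2 = y $ 1 * (y $ 2 * y $ 3 + y $ 1 + s0)"
      unfolding \<phi>_def vector_3 .
    moreover have "\<phi> y $ 3 = y $ 2 + t" by (simp add: \<phi>_def)
    ultimately have "\<phi> y \<in> A_surface 1"
      using eq by (simp only: A_surface_def mem_Collect_eq one_add_one)
    then show ?thesis using y by (simp add: \<phi>_def \<psi>_def vec3_eq_iff field_simps)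
  qed
  moreover have "\<psi> z \<in> cubic_surface s0 s1 \<inter> ?U \<and> \<phi> (\<psi> z) = z" if z: "z \<in> A_surface 1 \<inter> ?W" for z
  proof -
    have w: "\<psi> z $ 2 * \<psi> z $ 3 + \<psi> z $ 1 + s0 = z $ 1 - \<i> * z $ 2"
      using z by (simp add: \<psi>_def)
    have "peval (cubic s0 s1) (\<psi> z)
        = \<psi> z $ 1 * (\<psi> z $ 2 * \<psi> z $ 3 + \<psi> z $ 1 + s0) + (\<psi> z $ 2 + t)\<^sup>2"
      using t(1,2) by (simp add: peval_cubic power2_eq_square algebra_simps)
    also have "\<dots> = (z $ 1 + \<i> * z $ 2) * (z $ 1 - \<i> * z $ 2) + (z $ 3)\<^sup>2"
      unfolding w by (simp add: \<psi>_def)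
    also have "\<dots> = 0" using z by (simp add: A_surface_def power2_eq_square algebra_simps)
    finally have "\<psi> z \<in> cubic_surface s0 s1" by (simp add: cubic_surface_def)
    moreover have "\<phi> (\<psi> z) = z"
      unfolding \<phi>_def w by (simp add: \<psi>_def vec3_eq_iff)
    ultimately show ?thesis using z by (simp add: \<psi>_def)
  qed
  \<comment> \<open>At the origin of the new coordinates x1 = w = 0 and x2 = - t, whence x3 = s0 /
    t, which is s0 t because t^2 = 1.\<close>
  moreover have "vector [0, - s1 / 2, s0 * s1 / 2] \<in> cubic_surface s0 s1"
    "\<phi> (vector [0, - s1 / 2, s0 * s1 / 2]) = 0"
    using t by (auto simp: cubic_surface_def peval_cubic \<phi>_def vec3_eq_iff power2_eq_square algebra_simps)
  ultimately show ?thesis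
    unfolding singularity_of_type_A_def using hol t
    by (intro exI[of _ ?U] exI[of _ ?W] exI[of _ \<phi>] exI[of _ \<psi>]) auto
qed

lemma cubic_surface_type_A1':
  assumes "s0\<^sup>2 = 4"
  shows "singularity_of_type_A 1 (cubic_surface s0 s1) (vector [- s0 / 2, 0, s0 * s1 / 2])"
proof (rule singularity_of_type_A_transfer)
  let ?swap = "\<lambda>v :: complex ^ 3. vector [v $ 2, v $ 1, v $ 3] :: complex ^ 3"
  show "holomorphic_map_on ?swap UNIV" "holomorphic_map_on ?swap UNIV"
    by (rule holomorphic_map_on_3I; simp add: holomorphic_at_nth)+
  have swap: "?swap v \<in> cubic_surface s1 s0" if "v \<in> cubic_surface s0 s1" for v s0 s1
    using that by (simp add: cubic_surface_def peval_cubic ac_simps)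
  show "?swap y \<in> cubic_surface s1 s0 \<and> ?swap (?swap y) = y" if "y \<in> cubic_surface s0 s1" for y
    using swap[OF that] by (simp add: vec3_eq_iff)
  show "?swap y \<in> cubic_surface s0 s1 \<and> ?swap (?swap y) = y" if "y \<in> cubic_surface s1 s0" for y
    using swap[OF that] by (simp add: vec3_eq_iff)
  show "singularity_of_type_A 1 (cubic_surface s1 s0) (?swap (vector [- s0 / 2, 0, s0 * s1 / 2]))"
    using cubic_surface_type_A1[OF assms, of s1] by (simp add: mult.commute)
  show "vector [- s0 / 2, 0, s0 * s1 / 2] \<in> cubic_surface s0 s1"
    using assms by (simp add: cubic_surface_def peval_cubic power2_eq_square)
qed

section \<open>Singular points and degree of the cubic\<close>

definition cubic_singularities :: "complex \<Rightarrow> complex \<Rightarrow> (complex ^ 3) set"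
  where "cubic_singularities s0 s1 =
    (if s1\<^sup>2 = 4 then {vector [0, - s1 / 2, s0 * s1 / 2]} else {}) \<union>
    (if s0\<^sup>2 = 4 then {vector [- s0 / 2, 0, s0 * s1 / 2]} else {})"

text \<open>The three conditions are the vanishing of the partial derivatives; the last splits into
  x1 = 0 or x2 = 0. If x1 = 0, then x2 = - s1 / 2 and the cubic reduces to 1 - s1^2 / 4.\<close>

lemma cubic_singularities_eq:
  "cubic_singularities s0 s1 = {v \<in> cubic_surface s0 s1.
    v $ 2 * v $ 3 + 2 * v $ 1 + s0 = 0 \<and> v $ 1 * v $ 3 + 2 * v $ 2 + s1 = 0 \<and> v $ 1 * v $ 2 = 0}"
  (is "_ = ?S")
proof (intro equalityI subsetI)
  fix v assume "v \<in> cubic_singularities s0 s1"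
  then show "v \<in> ?S"
    by (auto simp: cubic_singularities_def cubic_surface_def peval_cubic power_divide
        power2_eq_square split: if_splits)
next
  fix v assume v: "v \<in> ?S"
  show "v \<in> cubic_singularities s0 s1"
  proof (cases "v $ 1 = 0")
    case True
    then have v2: "v $ 2 = - s1 / 2" and s0: "s0 = - v $ 2 * v $ 3"
      using v by (auto simp: field_simps eq_neg_iff_add_eq_0)
    have s1: "s1\<^sup>2 = 4"
      using v True v2 by (simp add: cubic_surface_def peval_cubic power2_eq_square field_simps)
    then have "v $ 3 = s0 * s1 / 2"
      unfolding s0 v2 by (simp add: power2_eq_square)
    then show ?thesis using True v2 s1 by (auto simp: cubic_singularities_def vec3_eq_iff)
  next
    case False
    then have "v $ 2 = 0" using v by simp
    then have v1: "v $ 1 = - s0 / 2" and s1: "s1 = - v $ 1 * v $ 3"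
      using v by (auto simp: field_simps eq_neg_iff_add_eq_0)
    have s0: "s0\<^sup>2 = 4"
      using v \<open>v $ 2 = 0\<close> v1 by (simp add: cubic_surface_def peval_cubic power2_eq_square field_simps)
    then have "v $ 3 = s0 * s1 / 2"
      unfolding s1 v1 by (simp add: power2_eq_square)
    then show ?thesis using \<open>v $ 2 = 0\<close> v1 s0 by (auto simp: cubic_singularities_def vec3_eq_iff)
  qed
qed

lemma card_cubic_singularities:
  "card (cubic_singularities s0 s1) = of_bool (s0\<^sup>2 = 4) + of_bool (s1\<^sup>2 = 4)"
proof -
  define p q :: "complex ^ 3"
    where "p = vector [0, - s1 / 2, s0 * s1 / 2]" and "q = vector [- s0 / 2, 0, s0 * s1 / 2]"
  \<comment> \<open>The second coordinates differ, as \<open>s1\<close> is nonzero.\<close>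
  have "p \<noteq> q" if "s1\<^sup>2 = 4" using that by (auto simp: p_def q_def vec3_eq_iff)
  then show ?thesis
    unfolding cubic_singularities_def p_def[symmetric] q_def[symmetric] by auto
qed

text \<open>Only an inclusion is available for the support, since \<open>s0\<close> and
  \<open>s1\<close> may be 0. The monomial of degree 3 survives because no other term has its
  exponent.\<close>

lemma total_degree_cubic: "total_degree (cubic s0 s1) = 3"
proof -
  let ?s = "Poly_Mapping.single :: 3 \<Rightarrow> nat \<Rightarrow> _"
  let ?deg = "\<lambda>m :: 3 \<Rightarrow>\<^sub>0 nat. \<Sum>i\<in>UNIV. Poly_Mapping.lookup m i"
  let ?M = "{?s 1 1 + ?s 2 1 + ?s 3 1, ?s 1 2, ?s 2 2, ?s 1 1, ?s 2 1, 0}"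
  have eq: "cubic s0 s1 = Poly_Mapping.single (?s 1 1 + ?s 2 1 + ?s 3 1) 1
      + Poly_Mapping.single (?s 1 2) 1 + Poly_Mapping.single (?s 2 2) 1
      + Poly_Mapping.single (?s 1 1) s0 + Poly_Mapping.single (?s 2 1) s1
      + Poly_Mapping.single 0 1"
    unfolding cubic_def single_Var_power
    by (simp add: Var_def Const_def mult_single power2_eq_square flip: single_add)
  have deg: "?deg (?s 1 1 + ?s 2 1 + ?s 3 1) = 3" "?deg (?s 1 2) = 2" "?deg (?s 2 2) = 2"
    "?deg (?s 1 1) = 1" "?deg (?s 2 1) = 1" "?deg 0 = 0"
    by (simp_all add: sum_3 lookup_add lookup_single when_def)
  have "Poly_Mapping.keys (cubic s0 s1) \<subseteq> ?M"
    unfolding eq by (intro order_trans[OF keys_add] Un_least) (auto simp: keys_single)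
  then have "?deg m \<le> 3" if "m \<in> Poly_Mapping.keys (cubic s0 s1)" for m
    using that deg by fastforce
  moreover have "?s 1 1 + ?s 2 1 + ?s 3 1 \<in> Poly_Mapping.keys (cubic s0 s1)"
  proof -
    \<comment> \<open>Comparing degrees shows the exponents to be distinct without comparing them
      entry by entry.\<close>
    have "?deg m \<noteq> 3" if "m \<in> {?s 1 2, ?s 2 2, ?s 1 1, ?s 2 1, 0}" for m
      using that by (elim insertE emptyE; hypsubst; simp only: deg; simp)
    then have 0: "Poly_Mapping.lookup (Poly_Mapping.single m c) (?s 1 1 + ?s 2 1 + ?s 3 1) = 0"
      if "m \<in> {?s 1 2, ?s 2 2, ?s 1 1, ?s 2 1, 0}" for m and c :: complex
      using that deg(1) by (intro lookup_single_not_eq) metis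
    have "Poly_Mapping.lookup (cubic s0 s1) (?s 1 1 + ?s 2 1 + ?s 3 1) = 1"
      unfolding eq lookup_add lookup_single_eq by (subst (1 2 3 4 5) 0) simp_all
    then show ?thesis by (simp add: in_keys_iff)
  qed
  ultimately show ?thesis
    unfolding total_degree_def using deg(1) by (intro Max_eqI) (auto intro!: rev_image_eqI)
qed

section \<open>The monodromy space as a hypersurface\<close>

lemma exhaust_5: "x = 1 \<or> x = 2 \<or> x = 3 \<or> x = 4 \<or> x = 5" for x :: 5
proof (induct x)
  case (of_int z)
  then have "z = 0 \<or> z = 1 \<or> z = 2 \<or> z = 3 \<or> z = 4" by fastforce
  then show ?case by auto
qed

lemma forall_5: "(\<forall>i::5. P i) \<longleftrightarrow> P 1 \<and> P 2 \<and> P 3 \<and> P 4 \<and> P 5"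
  by (metis exhaust_5)

lemma vector_5 [simp]:
  "(vector [a, b, c, d, e] :: 'a::zero ^ 5) $ 1 = a"
  "(vector [a, b, c, d, e] :: 'a::zero ^ 5) $ 2 = b"
  "(vector [a, b, c, d, e] :: 'a::zero ^ 5) $ 3 = c"
  "(vector [a, b, c, d, e] :: 'a::zero ^ 5) $ 4 = d"
  "(vector [a, b, c, d, e] :: 'a::zero ^ 5) $ 5 = e"
  unfolding vector_def by simp_all

lemma vec5_eq_iff: "(v :: 'a ^ 5) = w \<longleftrightarrow>
  v $ 1 = w $ 1 \<and> v $ 2 = w $ 2 \<and> v $ 3 = w $ 3 \<and> v $ 4 = w $ 4 \<and> v $ 5 = w $ 5"
  by (simp add: vec_eq_iff forall_5)

lemma forall_3_2_2:
  "(\<forall>j :: 3 \<times> 2 \<times> 2. P j) \<longleftrightarrow>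
    P (1, 1, 1) \<and> P (1, 1, 2) \<and> P (1, 2, 1) \<and> P (1, 2, 2) \<and>
    P (2, 1, 1) \<and> P (2, 1, 2) \<and> P (2, 2, 1) \<and> P (2, 2, 2) \<and>
    P (3, 1, 1) \<and> P (3, 1, 2) \<and> P (3, 2, 1) \<and> P (3, 2, 2)"
  by (auto simp: split_paired_All forall_3 forall_2)

lemma vec_3_2_2_eq_iff:
  "(T :: 'a ^ (3 \<times> 2 \<times> 2)) = T' \<longleftrightarrow>
    T $ (1, 1, 1) = T' $ (1, 1, 1) \<and> T $ (1, 1, 2) = T' $ (1, 1, 2) \<and>
    T $ (1, 2, 1) = T' $ (1, 2, 1) \<and> T $ (1, 2, 2) = T' $ (1, 2, 2) \<and>
    T $ (2, 1, 1) = T' $ (2, 1, 1) \<and> T $ (2, 1, 2) = T' $ (2, 1, 2) \<and>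
    T $ (2, 2, 1) = T' $ (2, 2, 1) \<and> T $ (2, 2, 2) = T' $ (2, 2, 2) \<and>
    T $ (3, 1, 1) = T' $ (3, 1, 1) \<and> T $ (3, 1, 2) = T' $ (3, 1, 2) \<and>
    T $ (3, 2, 1) = T' $ (3, 2, 1) \<and> T $ (3, 2, 2) = T' $ (3, 2, 2)"
  unfolding vec_eq_iff forall_3_2_2 by (rule refl)

text \<open>The entries of \<open>M1\<close> and the upper left entry \<open>- e\<close> of \<open>Minf\<close>, which determine the triple.\<close>

abbreviation "i\<^sub>a \<equiv> (2, 1, 1) :: 3 \<times> 2 \<times> 2"
abbreviation "i\<^sub>b \<equiv> (2, 1, 2) :: 3 \<times> 2 \<times> 2"
abbreviation "i\<^sub>c \<equiv> (2, 2, 1) :: 3 \<times> 2 \<times> 2"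
abbreviation "i\<^sub>d \<equiv> (2, 2, 2) :: 3 \<times> 2 \<times> 2"
abbreviation "i\<^sub>e \<equiv> (3, 1, 1) :: 3 \<times> 2 \<times> 2"

section \<open>The monodromy space in terms of matrix entries\<close>

lemma Minf_eq_iff:
  "Minf T = Minf_matrix e \<longleftrightarrow>
    T $ i\<^sub>e = - e \<and> T $ (3, 1, 2) = - 1 \<and> T $ (3, 2, 1) = 1 \<and> T $ (3, 2, 2) = 0"
  by (simp add: Minf_def Minf_matrix_def mat2_def matrix_matrix_mult_def vec_eq_iff forall_2 sum_2)

text \<open>With \<open>e\<close> the upper left entry of \<open>Minf\<close>, the product of
  \<open>M1\<close> and \<open>Minf\<close> has rows (a e + b, - a) and (c e + d, - c) and
  determinant a d - b c = 1, so \<open>M0\<close> has to be its adjugate.\<close>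

lemma left_inverse_iff:
  fixes a b c d e p q r s :: "'a::comm_ring_1"
  assumes "a * d - b * c = 1"
  shows "p * (a * e + b) + q * (c * e + d) = 1 \<and> - (p * a + q * c) = 0 \<and>
      r * (a * e + b) + s * (c * e + d) = 0 \<and> - (r * a + s * c) = 1 \<longleftrightarrow>
    p = - c \<and> q = a \<and> r = - (c * e) - d \<and> s = a * e + b" (is "?L \<longleftrightarrow> ?R")
proof
  \<comment> \<open>Cramer's rule for one row of the left factor.\<close>
  have solve: "(d + c * e) * (p * a + q * c) - c * (p * (a * e + b) + q * (c * e + d)) = p"
    "a * (p * (a * e + b) + q * (c * e + d)) - (b + a * e) * (p * a + q * c) = q" for p q
  proof -
    have "(d + c * e) * (p * a + q * c) - c * (p * (a * e + b) + q * (c * e + d)) = p * (a * d - b * c)"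
      "a * (p * (a * e + b) + q * (c * e + d)) - (b + a * e) * (p * a + q * c) = q * (a * d - b * c)"
      by (simp_all add: algebra_simps)
    then show "(d + c * e) * (p * a + q * c) - c * (p * (a * e + b) + q * (c * e + d)) = p"
      "a * (p * (a * e + b) + q * (c * e + d)) - (b + a * e) * (p * a + q * c) = q"
      by (simp_all add: assms)
  qed
  assume ?L
  then have L: "p * (a * e + b) + q * (c * e + d) = 1" "p * a + q * c = 0"
    "r * (a * e + b) + s * (c * e + d) = 0" "r * a + s * c = - 1"
    by (metis minus_minus neg_0_equal_iff_equal)+
  have "p = (d + c * e) * 0 - c * 1" "q = a * 1 - (b + a * e) * 0"
    "r = (d + c * e) * (- 1) - c * 0" "s = a * 0 - (b + a * e) * (- 1)"
    by (simp_all only: solve[of p q, unfolded L] solve[of r s, unfolded L])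
  then show ?R by simp
next
  assume ?R
  then have eq: "p = - c" "q = a" "r = - (c * e) - d" "s = a * e + b" by auto
  show ?L unfolding eq using assms by (simp add: algebra_simps)
qed

lemma mem_monodromy_space_iff:
  "T \<in> monodromy_space \<longleftrightarrow>
    T $ i\<^sub>a * T $ i\<^sub>d - T $ i\<^sub>b * T $ i\<^sub>c = 1 \<and>
    T $ (1, 1, 1) = - T $ i\<^sub>c \<and> T $ (1, 1, 2) = T $ i\<^sub>a \<and>
    T $ (1, 2, 1) = - (T $ i\<^sub>c * T $ i\<^sub>e) - T $ i\<^sub>d \<and> T $ (1, 2, 2) = T $ i\<^sub>a * T $ i\<^sub>e + T $ i\<^sub>b \<and>
    T $ (3, 1, 2) = - 1 \<and> T $ (3, 2, 1) = 1 \<and> T $ (3, 2, 2) = 0"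
proof -
  have "(\<exists>e. Minf T = Minf_matrix e) \<longleftrightarrow>
      T $ (3, 1, 2) = - 1 \<and> T $ (3, 2, 1) = 1 \<and> T $ (3, 2, 2) = 0"
    unfolding Minf_eq_iff by (auto intro: exI[of _ "- T $ i\<^sub>e"])
  moreover have "M0 T ** M1 T ** Minf T = mat 1 \<longleftrightarrow>
      T $ (1, 1, 1) = - T $ i\<^sub>c \<and> T $ (1, 1, 2) = T $ i\<^sub>a \<and>
      T $ (1, 2, 1) = - (T $ i\<^sub>c * T $ i\<^sub>e) - T $ i\<^sub>d \<and> T $ (1, 2, 2) = T $ i\<^sub>a * T $ i\<^sub>e + T $ i\<^sub>b"
    if "T $ i\<^sub>a * T $ i\<^sub>d - T $ i\<^sub>b * T $ i\<^sub>c = 1"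
      and Minf: "T $ (3, 1, 2) = - 1" "T $ (3, 2, 1) = 1" "T $ (3, 2, 2) = 0"
  proof -
    have "M0 T ** M1 T ** Minf T = mat 1 \<longleftrightarrow>
        T $ (1, 1, 1) * (T $ i\<^sub>a * T $ i\<^sub>e + T $ i\<^sub>b) + T $ (1, 1, 2) * (T $ i\<^sub>c * T $ i\<^sub>e + T $ i\<^sub>d) = 1 \<and>
        - (T $ (1, 1, 1) * T $ i\<^sub>a + T $ (1, 1, 2) * T $ i\<^sub>c) = 0 \<and>
        T $ (1, 2, 1) * (T $ i\<^sub>a * T $ i\<^sub>e + T $ i\<^sub>b) + T $ (1, 2, 2) * (T $ i\<^sub>c * T $ i\<^sub>e + T $ i\<^sub>d) = 0 \<and>
        - (T $ (1, 2, 1) * T $ i\<^sub>a + T $ (1, 2, 2) * T $ i\<^sub>c) = 1"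
      unfolding matrix_mul_assoc[symmetric]
      by (simp add: M0_def M1_def Minf_def matrix_matrix_mult_def vec_eq_iff forall_2 sum_2
          mat_def Minf conj_assoc)
    also have "\<dots> \<longleftrightarrow> T $ (1, 1, 1) = - T $ i\<^sub>c \<and> T $ (1, 1, 2) = T $ i\<^sub>a \<and>
      T $ (1, 2, 1) = - (T $ i\<^sub>c * T $ i\<^sub>e) - T $ i\<^sub>d \<and> T $ (1, 2, 2) = T $ i\<^sub>a * T $ i\<^sub>e + T $ i\<^sub>b"
      by (rule left_inverse_iff[OF that(1)])
    finally show ?thesis .
  qed
  \<comment> \<open>\<open>M0\<close> is the adjugate of a matrix of determinant a d - b c.\<close>
  moreover have "det (M0 T) = 1"
    if "T $ i\<^sub>a * T $ i\<^sub>d - T $ i\<^sub>b * T $ i\<^sub>c = 1"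
      and "T $ (1, 1, 1) = - T $ i\<^sub>c" "T $ (1, 1, 2) = T $ i\<^sub>a"
      "T $ (1, 2, 1) = - (T $ i\<^sub>c * T $ i\<^sub>e) - T $ i\<^sub>d" "T $ (1, 2, 2) = T $ i\<^sub>a * T $ i\<^sub>e + T $ i\<^sub>b"
    using that(1) by (simp add: det_2 M0_def that(2-) algebra_simps)
  moreover have "det (M1 T) = T $ i\<^sub>a * T $ i\<^sub>d - T $ i\<^sub>b * T $ i\<^sub>c"
    by (simp add: det_2 M1_def)
  ultimately show ?thesis unfolding monodromy_space_def mem_Collect_eq by metis
qed

text \<open>Replaces the definite description in \<open>stokes\<close> by a matrix entry, which
  makes all five functions polynomial.\<close>

lemma coords_monodromy_space:
  assumes "T \<in> monodromy_space"
  shows "coords T = vector [- T $ i\<^sub>b, - T $ i\<^sub>a, T $ i\<^sub>e, T $ (1, 1, 1) + T $ (1, 2, 2), T $ i\<^sub>a + T $ i\<^sub>d]"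
proof -
  from assms obtain e where "Minf T = Minf_matrix e" by (auto simp: monodromy_space_def)
  then have "stokes T = - T $ i\<^sub>e" using stokes_eq Minf_eq_iff by fastforce
  then show ?thesis by (simp add: coords_def trace_def sum_2 M0_def M1_def)
qed

definition coord_poly :: "5 \<Rightarrow> (3 \<times> 2 \<times> 2) mpoly"
  where "coord_poly i =
    (if i = 1 then - Var i\<^sub>b else if i = 2 then - Var i\<^sub>a else if i = 3 then Var i\<^sub>e
     else if i = 4 then Var (1, 1, 1) + Var (1, 2, 2) else Var i\<^sub>a + Var i\<^sub>d)"

lemma coords_eq_peval: "T \<in> monodromy_space \<Longrightarrow> coords T $ i = peval (coord_poly i) T"
  using exhaust_5[of i] by (auto simp: coords_monodromy_space coord_poly_def)

text \<open>Inverse of \<open>coords\<close>: d comes from s1 = a + d, and c from s0 = - c + a e +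
  b, the trace of the adjugate.\<close>

definition section_poly :: "3 \<times> 2 \<times> 2 \<Rightarrow> 5 mpoly"
  where "section_poly j =
    (let a = - Var 2; b = - Var 1; c = - (Var 2 * Var 3) - Var 1 - Var 4; d = Var 5 + Var 2; e = Var 3
     in if j = (1, 1, 1) then - c else if j = (1, 1, 2) then a
        else if j = (1, 2, 1) then - (c * e) - d else if j = (1, 2, 2) then a * e + b
        else if j = i\<^sub>a then a else if j = i\<^sub>b then b else if j = i\<^sub>c then c else if j = i\<^sub>d then d
        else if j = i\<^sub>e then e else if j = (3, 1, 2) then - 1 else if j = (3, 2, 1) then 1 else 0)"

definition monodromy_section :: "complex ^ 5 \<Rightarrow> triple"
  where "monodromy_section v = (\<chi> j. peval (section_poly j) v)"

lemma peval_family_poly: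
  "peval family_poly v = v $ 1 * v $ 2 * v $ 3 + (v $ 1)\<^sup>2 + (v $ 2)\<^sup>2 + v $ 4 * v $ 1 + v $ 5 * v $ 2 + 1"
  by (simp add: family_poly_def)

lemma family_poly_coords: "T \<in> monodromy_space \<Longrightarrow> peval family_poly (coords T) = 0"
  by (simp add: coords_monodromy_space peval_family_poly)
     (simp add: mem_monodromy_space_iff power2_eq_square algebra_simps)

lemma monodromy_section_in_monodromy_space:
  assumes "peval family_poly v = 0"
  shows "monodromy_section v \<in> monodromy_space"
proof -
  \<comment> \<open>The left side is a d - b c for the section, so the family equation says that
    \<open>M1\<close> has determinant 1.\<close>
  have "v $ 1 * (- (v $ 2 * v $ 3) - v $ 1 - v $ 4) - v $ 2 * (v $ 5 + v $ 2)
      = 1 - peval family_poly v"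
    by (simp add: peval_family_poly power2_eq_square algebra_simps)
  then show ?thesis
    by (simp add: assms mem_monodromy_space_iff monodromy_section_def section_poly_def Let_def)
qed

lemma coords_monodromy_section:
  "peval family_poly v = 0 \<Longrightarrow> coords (monodromy_section v) = v"
  by (simp add: coords_monodromy_space monodromy_section_in_monodromy_space vec5_eq_iff)
     (simp add: monodromy_section_def section_poly_def Let_def)

lemma monodromy_section_coords: "T \<in> monodromy_space \<Longrightarrow> monodromy_section (coords T) = T"
  by (simp add: coords_monodromy_space monodromy_section_def section_poly_def Let_def
      vec_3_2_2_eq_iff) (simp add: mem_monodromy_space_iff)

text \<open>The coefficients \<open>p\<close> and \<open>q\<close> are variables in the family and
  constants on a fibre. Both cancellations use the origin, where the polynomial is 1.\<close>

lemma reduced_equation_cubic: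
  assumes "i \<noteq> k" "j \<noteq> k" "depends_only_on p (- {k})" "depends_only_on q (- {k})"
  shows "reduced_equation (Var i * Var j * Var k + Var i ^ 2 + Var j ^ 2 + p * Var i + q * Var j + 1)"
    (is "reduced_equation ?f")
proof (rule reduced_equation_linear)
  show "?f = Var i * Var j * Var k + (Var i ^ 2 + Var j ^ 2 + p * Var i + q * Var j + 1)"
    by (simp add: add.assoc)
  show "depends_only_on (Var i * Var j) (- {k})"
    "depends_only_on (Var i ^ 2 + Var j ^ 2 + p * Var i + q * Var j + 1) (- {k})"
    using assms by (auto intro!: depends_only_on_intros)
  show "Var i * Var j \<noteq> 0" by (rule peval_neq_0D[of _ "\<chi> i. 1"]) simp
  have 0: "peval ?f 0 \<noteq> 0" by simp
  show "?f dvd u" if "?f dvd Var i * Var j * u" for u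
    using dvd_Var_mult_cancel[OF dvd_Var_mult_cancel[OF that[unfolded mult.assoc[of _ _ u]], of 0], of 0] 0 by simp
qed

lemma reduced_equation_det:
  assumes "i\<noteq> l" "j \<noteq> l" "k \<noteq> l"
  shows "reduced_equation (Var i * Var l - Var j * Var k - 1)" (is "reduced_equation ?f")
proof (rule reduced_equation_linear)
  show "?f = Var i * Var l + (- (Var j * Var k) - 1)" by simp
  show "depends_only_on (Var i) (- {l})" "depends_only_on (- (Var j * Var k) - 1) (- {l})"
    using assms by (auto intro!: depends_only_on_intros)
  show "Var i \<noteq> 0" by (rule peval_neq_0D[of _ "\<chi> i. 1"]) simp
  have 0: "peval ?f 0 \<noteq> 0" by simp
  show "?f dvd u" if "?f dvd Var i * u" for u
    using dvd_Var_mult_cancel[OF that, of 0] 0 by simp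
qed

lemma coordinate_ring_monodromy_space:
  "coordinate_ring_presentation monodromy_space coords family_poly"
proof (rule coordinate_ring_presentationI)
  show "reduced_equation family_poly"
    unfolding family_poly_def by (rule reduced_equation_cubic) auto
  show "\<exists>T\<in>monodromy_space. coords T = v" if "peval family_poly v = 0" for v
    using coords_monodromy_section monodromy_section_in_monodromy_space that by blast
  show "peval (section_poly i) (coords T) = T $ i" if "T \<in> monodromy_space" for T i
    using arg_cong[OF monodromy_section_coords[OF that], of "\<lambda>T. T $ i"]
    by (simp add: monodromy_section_def)
qed (simp_all add: coords_eq_peval family_poly_coords)

text \<open>Right-hand sides of \<open>mem_monodromy_space_iff\<close>; the final 0 is the entry
  \<open>(3, 2, 2)\<close>.\<close>

definition monodromy_eqs :: "3 \<times> 2 \<times> 2 \<Rightarrow> (3 \<times> 2 \<times> 2) mpoly"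
  where "monodromy_eqs j =
    (if j = (1, 1, 1) then - Var i\<^sub>c else if j = (1, 1, 2) then Var i\<^sub>a
     else if j = (1, 2, 1) then - (Var i\<^sub>c * Var i\<^sub>e) - Var i\<^sub>d
     else if j = (1, 2, 2) then Var i\<^sub>a * Var i\<^sub>e + Var i\<^sub>b
     else if j = (3, 1, 2) then - 1 else if j = (3, 2, 1) then 1 else 0)"

lemma monodromy_graph: "hypersurface_graph {i\<^sub>a, i\<^sub>b, i\<^sub>c, i\<^sub>d, i\<^sub>e} monodromy_eqs
  (Var i\<^sub>a * Var i\<^sub>d - Var i\<^sub>b * Var i\<^sub>c - 1)"
proof
  show "depends_only_on (monodromy_eqs j) {i\<^sub>a, i\<^sub>b, i\<^sub>c, i\<^sub>d, i\<^sub>e}" for j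
    by (auto simp: monodromy_eqs_def intro!: depends_only_on_intros)
  show "depends_only_on (Var i\<^sub>a * Var i\<^sub>d - Var i\<^sub>b * Var i\<^sub>c - 1) {i\<^sub>a, i\<^sub>b, i\<^sub>c, i\<^sub>d, i\<^sub>e}"
    by (intro depends_only_on_intros) auto
  show "reduced_equation (Var i\<^sub>a * Var i\<^sub>d - Var i\<^sub>b * Var i\<^sub>c - 1)"
    by (rule reduced_equation_det) auto
  show "Var i\<^sub>a * Var i\<^sub>d - Var i\<^sub>b * Var i\<^sub>c - 1 \<noteq> (0 :: (3 \<times> 2 \<times> 2) mpoly)"
    by (rule peval_neq_0D[of _ 0]) simp
qed

lemma monodromy_space_eq_graph:
  "monodromy_space = hypersurface_graph.graph {i\<^sub>a, i\<^sub>b, i\<^sub>c, i\<^sub>d, i\<^sub>e} monodromy_eqs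
    (Var i\<^sub>a * Var i\<^sub>d - Var i\<^sub>b * Var i\<^sub>c - 1)" (is "_ = ?G")
proof -
  have "T \<in> monodromy_space \<longleftrightarrow> T \<in> ?G" for T
    unfolding mem_monodromy_space_iff hypersurface_graph.graph_def[OF monodromy_graph]
      mem_Collect_eq forall_3_2_2
    by (simp add: monodromy_eqs_def) argo
  then show ?thesis by blast
qed

text \<open>Up to sign and order the gradient consists of the entries of \<open>M1\<close>, which
  cannot all vanish when the determinant is 1.\<close>

lemma nonsingular_at_monodromy_space:
  assumes "T \<in> monodromy_space"
  shows "nonsingular_at monodromy_space T"
  unfolding monodromy_space_eq_graph
proof (rule hypersurface_graph.nonsingular_at_graphI[OF monodromy_graph], rule notI)
  let ?g = "gradient (Var i\<^sub>a * Var i\<^sub>d - Var i\<^sub>b * Var i\<^sub>c - 1) T"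
  assume "?g = 0"
  then have "?g $ j = 0" for j by simp
  from this[of i\<^sub>a] this[of i\<^sub>b] this[of i\<^sub>c] this[of i\<^sub>d] assms show False
    by (simp add: axis_def mem_monodromy_space_iff)
qed

section \<open>The fibres\<close>

definition family_point :: "complex \<Rightarrow> complex \<Rightarrow> complex ^ 3 \<Rightarrow> complex ^ 5"
  where "family_point s0 s1 v = vector [v $ 1, v $ 2, v $ 3, s0, s1]"

lemma family_poly_family_point: "peval family_poly (family_point s0 s1 v) = peval (cubic s0 s1) v"
  by (simp add: peval_family_poly peval_cubic family_point_def)

lemma fibre_subset_monodromy_space: "T \<in> fibre s0 s1 \<Longrightarrow> T \<in> monodromy_space"
  by (simp add: fibre_def)

lemma coords_fibre: "T \<in> fibre s0 s1 \<Longrightarrow> coords T = family_point s0 s1 (fibre_coords T)"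
  by (simp add: fibre_def coords_def fibre_coords_def family_point_def)

lemma fibre_coords_eq: "fibre_coords T $ 1 = coords T $ 1" "fibre_coords T $ 2 = coords T $ 2"
  "fibre_coords T $ 3 = coords T $ 3"
  by (simp_all add: coords_def fibre_coords_def)

lemma fibre_coords_in_cubic_surface: "T \<in> fibre s0 s1 \<Longrightarrow> fibre_coords T \<in> cubic_surface s0 s1"
  using family_poly_coords[of T] coords_fibre[of T s0 s1]
  by (simp add: family_poly_family_point cubic_surface_def fibre_def)

definition fibre_section :: "complex \<Rightarrow> complex \<Rightarrow> complex ^ 3 \<Rightarrow> triple"
  where "fibre_section s0 s1 v = monodromy_section (family_point s0 s1 v)"

lemma fibre_section_fibre_coords: "T \<in> fibre s0 s1 \<Longrightarrow> fibre_section s0 s1 (fibre_coords T) = T"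
  by (simp add: fibre_section_def monodromy_section_coords fibre_subset_monodromy_space flip: coords_fibre)

lemma fibre_section_cubic_surface:
  assumes "v \<in> cubic_surface s0 s1"
  shows "fibre_section s0 s1 v \<in> fibre s0 s1" "fibre_coords (fibre_section s0 s1 v) = v"
proof -
  let ?T = "fibre_section s0 s1 v"
  have 0: "peval family_poly (family_point s0 s1 v) = 0"
    using assms by (simp add: family_poly_family_point cubic_surface_def)
  have "?T \<in> monodromy_space"
    unfolding fibre_section_def by (rule monodromy_section_in_monodromy_space[OF 0])
  moreover have *: "coords ?T = family_point s0 s1 v"
    unfolding fibre_section_def by (rule coords_monodromy_section[OF 0])
  then have "coords ?T $ 4 = s0" "coords ?T $ 5 = s1" by (simp_all add: family_point_def)
  ultimately show "?T \<in> fibre s0 s1" by (simp add: fibre_def coords_def)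
  show "fibre_coords ?T = v"
    by (simp add: vec3_eq_iff fibre_coords_eq *) (simp add: family_point_def)
qed

lemma bij_betw_fibre_coords: "bij_betw fibre_coords (fibre s0 s1) (cubic_surface s0 s1)"
  by (rule bij_betw_byWitness[of _ "fibre_section s0 s1"])
     (auto simp: fibre_section_fibre_coords fibre_section_cubic_surface fibre_coords_in_cubic_surface)

definition fibre_coord_poly :: "3 \<Rightarrow> (3 \<times> 2 \<times> 2) mpoly"
  where "fibre_coord_poly i = (if i = 1 then - Var i\<^sub>b else if i = 2 then - Var i\<^sub>a else Var i\<^sub>e)"

lemma fibre_coords_eq_peval:
  assumes "T \<in> monodromy_space"
  shows "fibre_coords T = (\<chi> i. peval (fibre_coord_poly i) T)"
  by (simp add: vec3_eq_iff fibre_coords_eq coords_monodromy_space[OF assms] fibre_coord_poly_def)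

definition family_point_poly :: "complex \<Rightarrow> complex \<Rightarrow> 5 \<Rightarrow> 3 mpoly"
  where "family_point_poly s0 s1 i =
    (if i = 1 then Var 1 else if i = 2 then Var 2 else if i = 3 then Var 3
     else if i = 4 then Const s0 else Const s1)"

lemma family_point_eq_peval: "family_point s0 s1 v = (\<chi> i. peval (family_point_poly s0 s1 i) v)"
  by (simp add: vec5_eq_iff family_point_def family_point_poly_def)

lemma fibre_section_eq_peval:
  "fibre_section s0 s1 v = (\<chi> j. peval (psubst (family_point_poly s0 s1) (section_poly j)) v)"
  by (simp add: fibre_section_def monodromy_section_def family_point_eq_peval)

lemma coordinate_ring_fibre:
  "coordinate_ring_presentation (fibre s0 s1) fibre_coords (cubic s0 s1)"
proof (rule coordinate_ring_presentationI)
  show "reduced_equation (cubic s0 s1)"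
    unfolding cubic_def by (rule reduced_equation_cubic) auto
  show "fibre_coords T $ i = peval (fibre_coord_poly i) T" if "T \<in> fibre s0 s1" for T i
    using fibre_coords_eq_peval[OF fibre_subset_monodromy_space[OF that]] by simp
  show "peval (cubic s0 s1) (fibre_coords T) = 0" if "T \<in> fibre s0 s1" for T
    using fibre_coords_in_cubic_surface[OF that] by (simp add: cubic_surface_def)
  show "\<exists>T\<in>fibre s0 s1. fibre_coords T = v" if "peval (cubic s0 s1) v = 0" for v
    using fibre_section_cubic_surface[of v s0 s1] that by (auto simp: cubic_surface_def)
  show "peval (psubst (family_point_poly s0 s1) (section_poly j)) (fibre_coords T) = T $ j"
    if "T \<in> fibre s0 s1" for T j
    using arg_cong[OF fibre_section_fibre_coords[OF that], of "\<lambda>T. T $ j"]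
    by (simp add: fibre_section_eq_peval)
qed

text \<open>On a fibre the two traces also eliminate c and d.\<close>

definition fibre_eqs :: "complex \<Rightarrow> complex \<Rightarrow> 3 \<times> 2 \<times> 2 \<Rightarrow> (3 \<times> 2 \<times> 2) mpoly"
  where "fibre_eqs s0 s1 j =
    (let a = Var i\<^sub>a; b = Var i\<^sub>b; e = Var i\<^sub>e; c = a * e + b - Const s0; d = Const s1 - a
     in if j = i\<^sub>c then c else if j = i\<^sub>d then d
        else if j = (1, 1, 1) then - c else if j = (1, 1, 2) then a
        else if j = (1, 2, 1) then - (c * e) - d else if j = (1, 2, 2) then a * e + b
        else if j = (3, 1, 2) then - 1 else if j = (3, 2, 1) then 1 else 0)"

text \<open>The polynomial \<open>cubic\<close> after x1 = - b, x2 = - a and x3 =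
  \<open>T $ i\<^sub>e\<close>, which reverses the signs of the trace terms.\<close>

definition fibre_cubic :: "complex \<Rightarrow> complex \<Rightarrow> (3 \<times> 2 \<times> 2) mpoly"
  where "fibre_cubic s0 s1 = Var i\<^sub>b * Var i\<^sub>a * Var i\<^sub>e + Var i\<^sub>b ^ 2 + Var i\<^sub>a ^ 2
    + Const (- s0) * Var i\<^sub>b + Const (- s1) * Var i\<^sub>a + 1"

lemma fibre_graph: "hypersurface_graph {i\<^sub>a, i\<^sub>b, i\<^sub>e} (fibre_eqs s0 s1) (fibre_cubic s0 s1)"
proof
  show "depends_only_on (fibre_eqs s0 s1 j) {i\<^sub>a, i\<^sub>b, i\<^sub>e}" for j
    by (auto simp: fibre_eqs_def Let_def intro!: depends_only_on_intros)
  show "depends_only_on (fibre_cubic s0 s1) {i\<^sub>a, i\<^sub>b, i\<^sub>e}"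
    unfolding fibre_cubic_def by (intro depends_only_on_intros) auto
  show "reduced_equation (fibre_cubic s0 s1)"
    unfolding fibre_cubic_def by (rule reduced_equation_cubic) auto
  show "fibre_cubic s0 s1 \<noteq> 0"
    by (rule peval_neq_0D[of _ 0]) (simp add: fibre_cubic_def)
qed

lemma fibre_eq_graph:
  "fibre s0 s1 = hypersurface_graph.graph {i\<^sub>a, i\<^sub>b, i\<^sub>e} (fibre_eqs s0 s1) (fibre_cubic s0 s1)"
  (is "_ = ?G")
proof -
  note graph_def = hypersurface_graph.graph_def[OF fibre_graph]
  have tr: "trace (M0 T) = T $ (1, 1, 1) + T $ (1, 2, 2)" "trace (M1 T) = T $ i\<^sub>a + T $ i\<^sub>d" for T
    by (simp_all add: trace_def sum_2 M0_def M1_def)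
  \<comment> \<open>With c and d eliminated, the cubic is exactly the defect of the determinant of
    \<open>M1\<close> from 1.\<close>
  have cubic: "peval (fibre_cubic s0 s1) T = 1 - (T $ i\<^sub>a * T $ i\<^sub>d - T $ i\<^sub>b * T $ i\<^sub>c)"
    if "T $ i\<^sub>d = s1 - T $ i\<^sub>a" "T $ i\<^sub>c = T $ i\<^sub>a * T $ i\<^sub>e + T $ i\<^sub>b - s0" for T
    unfolding that by (simp add: fibre_cubic_def power2_eq_square algebra_simps)
  have "T \<in> fibre s0 s1 \<longleftrightarrow> T \<in> ?G" for T
  proof
    assume T: "T \<in> fibre s0 s1"
    then have *: "T $ i\<^sub>d = s1 - T $ i\<^sub>a" "T $ i\<^sub>c = T $ i\<^sub>a * T $ i\<^sub>e + T $ i\<^sub>b - s0"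
      by (auto simp: fibre_def tr mem_monodromy_space_iff)
    then have "peval (fibre_cubic s0 s1) T = 0"
      using T by (subst cubic) (simp_all only: fibre_def mem_Collect_eq mem_monodromy_space_iff, simp)
    then show "T \<in> ?G" using T * unfolding graph_def mem_Collect_eq forall_3_2_2
      by (simp add: fibre_def mem_monodromy_space_iff fibre_eqs_def Let_def)
  next
    assume T: "T \<in> ?G"
    then have *: "T $ i\<^sub>d = s1 - T $ i\<^sub>a" "T $ i\<^sub>c = T $ i\<^sub>a * T $ i\<^sub>e + T $ i\<^sub>b - s0"
      unfolding graph_def mem_Collect_eq forall_3_2_2 by (simp_all add: fibre_eqs_def Let_def)
    have "peval (fibre_cubic s0 s1) T = 0" using T unfolding graph_def by blast
    then have "T $ i\<^sub>a * T $ i\<^sub>d - T $ i\<^sub>b * T $ i\<^sub>c = 1"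
      unfolding cubic[OF *] by simp
    then show "T \<in> fibre s0 s1" using T * unfolding graph_def mem_Collect_eq forall_3_2_2
      by (simp add: fibre_def tr mem_monodromy_space_iff fibre_eqs_def Let_def)
  qed
  then show ?thesis by blast
qed

text \<open>Of the twelve components of the gradient only three can be nonzero. They are the partial
  derivatives of \<open>cubic\<close>, the first two with opposite sign.\<close>

lemma singular_points_fibre:
  "singular_points (fibre s0 s1) = {T \<in> fibre s0 s1. fibre_coords T \<in> cubic_singularities s0 s1}"
proof -
  have "gradient (fibre_cubic s0 s1) T = 0 \<longleftrightarrow> fibre_coords T \<in> cubic_singularities s0 s1"
    if T: "T \<in> fibre s0 s1" for T
  proof -
    have "gradient (fibre_cubic s0 s1) T = 0 \<longleftrightarrow>
        T $ i\<^sub>a * T $ i\<^sub>e + 2 * T $ i\<^sub>b - s0 = 0 \<and> T $ i\<^sub>b * T $ i\<^sub>e + 2 * T $ i\<^sub>a - s1 = 0 \<and>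
        T $ i\<^sub>b * T $ i\<^sub>a = 0"
      by (auto simp: vec_3_2_2_eq_iff fibre_cubic_def axis_def ac_simps)
    also have "\<dots> \<longleftrightarrow> fibre_coords T \<in> cubic_singularities s0 s1"
      using fibre_coords_in_cubic_surface[OF T] fibre_subset_monodromy_space[OF T]
      by (auto simp: cubic_singularities_eq fibre_coords_eq coords_monodromy_space algebra_simps)
    finally show ?thesis .
  qed
  then show ?thesis
    using hypersurface_graph.singular_points_graph[OF fibre_graph[of s0 s1]] unfolding fibre_eq_graph[symmetric] by blast
qed

lemma bij_betw_singular_points:
  "bij_betw fibre_coords (singular_points (fibre s0 s1)) (cubic_singularities s0 s1)"
proof -
  have "fibre_coords ` singular_points (fibre s0 s1) = fibre_coords ` fibre s0 s1 \<inter> cubic_singularities s0 s1"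
    unfolding singular_points_fibre by auto
  also have "\<dots> = cubic_singularities s0 s1"
    unfolding bij_betw_imp_surj_on[OF bij_betw_fibre_coords] cubic_singularities_eq by blast
  finally show ?thesis
    by (rule bij_betw_subset[OF bij_betw_fibre_coords, rotated]) (auto simp: singular_points_fibre)
qed

text \<open>The transfer needs a map that is holomorphic on the whole ambient space.
  \<open>fibre_coords\<close> contains a definite description, so the polynomials that agree with it
  on the fibre take its place.\<close>

lemma singularity_of_type_A1_fibre:
  assumes "T \<in> singular_points (fibre s0 s1)"
  shows "singularity_of_type_A 1 (fibre s0 s1) T"
proof (rule singularity_of_type_A_transfer)
  from assms have T: "T \<in> fibre s0 s1" and sing: "fibre_coords T \<in> cubic_singularities s0 s1"
    by (auto simp: singular_points_fibre)
  have \<alpha>: "(\<chi> i. peval (fibre_coord_poly i) T) = fibre_coords T" if "T \<in> fibre s0 s1" for T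
    using fibre_coords_eq_peval[OF fibre_subset_monodromy_space[OF that]] by simp
  show "T \<in> fibre s0 s1" by fact
  show "singularity_of_type_A 1 (cubic_surface s0 s1) (\<chi> i. peval (fibre_coord_poly i) T)"
    unfolding \<alpha>[OF T] using sing
    by (auto simp: cubic_singularities_def simp del: divide_minus_left One_nat_def split: if_splits
        intro: cubic_surface_type_A1 cubic_surface_type_A1')
  show "holomorphic_map_on (\<lambda>T. \<chi> i. peval (fibre_coord_poly i) T) UNIV"
    by (rule holomorphic_map_onI) (simp_all add: holomorphic_at_peval)
  show "holomorphic_map_on (fibre_section s0 s1) UNIV"
    unfolding fibre_section_eq_peval
    by (rule holomorphic_map_onI) (simp_all add: holomorphic_at_peval del: peval_psubst)
  show "(\<chi> i. peval (fibre_coord_poly i) T) \<in> cubic_surface s0 s1 \<and>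
      fibre_section s0 s1 (\<chi> i. peval (fibre_coord_poly i) T) = T" if "T \<in> fibre s0 s1" for T
    unfolding \<alpha>[OF that]
    by (intro conjI fibre_coords_in_cubic_surface fibre_section_fibre_coords that)
  show "fibre_section s0 s1 v \<in> fibre s0 s1 \<and>
      (\<chi> i. peval (fibre_coord_poly i) (fibre_section s0 s1 v)) = v" if "v \<in> cubic_surface s0 s1" for v
    using fibre_section_cubic_surface[OF that] \<alpha> by simp
qed

theorem mainTheorem4:
  shows "algebraic_set monodromy_space \<and>
    coordinate_ring_presentation monodromy_space coords family_poly \<and>
    (\<forall>s0 s1. total_degree (cubic s0 s1) = 3 \<and>
       bij_betw fibre_coords (fibre s0 s1) {v. peval (cubic s0 s1) v = 0} \<and>
       coordinate_ring_presentation (fibre s0 s1) fibre_coords (cubic s0 s1)) \<and>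
    (\<forall>T \<in> monodromy_space. nonsingular_at monodromy_space T) \<and>
    (\<forall>s0 s1. singular_points (fibre s0 s1) \<noteq> {} \<longleftrightarrow> s0 \<in> {2, -2} \<or> s1 \<in> {2, -2}) \<and>
    (\<forall>s0 s1. (s0 \<in> {2, -2}) \<noteq> (s1 \<in> {2, -2}) \<longrightarrow> card (singular_points (fibre s0 s1)) = 1) \<and>
    (\<forall>s0 s1. s0 \<in> {2, -2} \<and> s1 \<in> {2, -2} \<longrightarrow> card (singular_points (fibre s0 s1)) = 2) \<and>
    (\<forall>s0 s1. \<forall>T \<in> singular_points (fibre s0 s1). singularity_of_type_A 1 (fibre s0 s1) T)"
proof -
  have sq: "s\<^sup>2 = 4 \<longleftrightarrow> s \<in> {2, -2}" for s :: complex
    using power2_eq_iff[of s 2] by simp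
  have card: "card (singular_points (fibre s0 s1)) = of_bool (s0 \<in> {2, -2}) + of_bool (s1 \<in> {2, -2})"
    for s0 s1
    using bij_betw_same_card[OF bij_betw_singular_points] by (simp only: card_cubic_singularities sq)
  have nonempty: "singular_points (fibre s0 s1) \<noteq> {} \<longleftrightarrow> s0 \<in> {2, -2} \<or> s1 \<in> {2, -2}" for s0 s1
  proof -
    have "singular_points (fibre s0 s1) \<noteq> {} \<longleftrightarrow> cubic_singularities s0 s1 \<noteq> {}"
      using bij_betw_imp_surj_on[OF bij_betw_singular_points] by (metis image_is_empty)
    then show ?thesis by (simp add: cubic_singularities_def sq del: insert_iff)
  qed
  have one: "(s0 \<in> {2, -2}) \<noteq> (s1 \<in> {2, -2}) \<longrightarrow> card (singular_points (fibre s0 s1)) = 1" for s0 s1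
    unfolding card by (auto simp del: insert_iff)
  have two: "s0 \<in> {2, -2} \<and> s1 \<in> {2, -2} \<longrightarrow> card (singular_points (fibre s0 s1)) = 2" for s0 s1
    unfolding card by (auto simp del: insert_iff)
  have "algebraic_set monodromy_space"
    unfolding monodromy_space_eq_graph by (rule hypersurface_graph.algebraic_graph[OF monodromy_graph])
  then show ?thesis
    using coordinate_ring_monodromy_space total_degree_cubic coordinate_ring_fibre
      bij_betw_fibre_coords[unfolded cubic_surface_def] nonsingular_at_monodromy_space
      nonempty one two singularity_of_type_A1_fibre
    by (intro conjI allI ballI)
qed

end
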